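(* Let $k$ be an algebraically closed field, let $d\geq 0$ be an integer, and let $(\mathcal{T},\mathcal{T}^p,\mathcal{S})$ be a $(-d)$-Calabi-Yau triple over $k$. Let $X\in\mathcal{T}$ and $Y\in\mathcal{S}$. Then, for any integer $j$ and any choice of truncation triangles for $X$, we have $$(\mathcal{T}/\mathcal{T}^p)(\Sigma^jY,X)\cong\mathcal{T}(\Sigma^jY,X_{\leq -j+d-1}).$$
   Context: Conventions. $\mathcal{T}(X,Y)$ denotes the Hom-space in $\mathcal{T}$, $\Sigma$ is the suspension, $D=\mathrm{Hom}_k(-,k)$. For a subcategory (or collection of objects) $\mathcal{X}$ of $\mathcal{T}$: $\mathcal{X}^\perp=\{T\mid\mathcal{T}(\mathcal{X},T)=0\}$, ${}^\perp\mathcal{X}=\{T\mid\mathcal{T}(T,\mathcal{X})=0\}$. $\mathcal{X}*\mathcal{Y}$ is the full subcategory of objects $T$ fitting in a triangle $X\to T\to Y\to\Sigma X$ with $X\in\mathcal{X}$, $Y\in\mathcal{Y}$; if $\mathcal{T}(\mathcal{X},\mathcal{Y})=0$ it is written $\mathcal{X}\perp\mathcal{Y}$. $\Sigma^{\geq 0}\mathcal{S}$ means $\{\Sigma^m S\mid m\geq 0,\ S\in\mathcal{S}\}$, and similarly for $\Sigma^{<0}\mathcal{S}$ etc. A torsion pair is a pair $(\mathcal{A},\mathcal{B})$ of full subcategories closed under direct summands with $\mathcal{T}=\mathcal{A}\perp\mathcal{B}$; a co-$t$-structure is a torsion pair with $\Sigma^{-1}\mathcal{A}\subseteq\mathcal{A}$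 (equivalently $\Sigma\mathcal{B}\subseteq\mathcal{B}$). Simple minded collection (SMC). In a $k$-linear, Hom-finite, Krull-Schmidt triangulated category $\mathcal{T}$, a collection $\mathcal{S}$ is an SMC if for all $X,Y\in\mathcal{S}$: $\mathcal{T}(X,\Sigma^{m}Y)=0$ for all $m<0$; $\dim_k\mathcal{T}(X,Y)=\delta_{XY}$; and $\mathrm{thick}(\mathcal{S})=\mathcal{T}$. $(-d)$-Calabi-Yau triple $(\mathcal{T},\mathcal{T}^p,\mathcal{S})$: (RS0) $\mathcal{T}$ is a $k$-linear, Hom-finite, Krull-Schmidt triangulated category and $\mathcal{T}^p$ is a thick subcategory of $\mathcal{T}$; (RS1) with $\mathbb{S}=\Sigma^{-d}$, there is a bifunctorial isomorphism $D\mathcal{T}(X,Y)\cong\mathcal{T}(Y,\mathbb{S}X)$ for $X\in\mathcal{T}^p$, $Y\in\mathcal{T}$; (RS2) $\mathcal{S}$ is an SMC in $\mathcal{T}$, and $\mathcal{T}={}^\perp(\Sigma^{\geq 0}\mathcal{S})\perp{}^\perp(\Sigma^{<0}\mathcal{S})=(\Sigma^{\geq 0}\mathcal{S})^\perp\perp(\Sigma^{<0}\mathcal{S})^\perp$ are co-$t$-structures on $\mathcal{T}$ with ${}^\perp(\Sigma^{\geq 0}\mathcal{S})\subset\mathcal{T}^p$ and $(\Sigma^{<0}\mathcal{S})^\perp\subset\mathcal{T}^p$. $\mathcal{T}/\mathcal{T}^p$ denotes the Verdier quotient, which has the same objects as $\mathcal{T}$. Truncations. For $i\in\mathbb{Z}$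 put $\mathcal{T}_{>i}={}^\perp(\Sigma^{>-i-1}\mathcal{S})$ and $\mathcal{T}_{\leq i}={}^\perp(\Sigma^{<-i}\mathcal{S})$. Then $(\mathcal{T}_{>i},\mathcal{T}_{\leq i})$ is a co-$t$-structure, so each $X\in\mathcal{T}$ has a (non-unique) truncation triangle $X_{>i}\xrightarrow{f_i}X\xrightarrow{g_i}X_{\leq i}\to\Sigma X_{>i}$ with $X_{>i}\in\mathcal{T}_{>i}$, $X_{\leq i}\in\mathcal{T}_{\leq i}$; $X_{>i}$ and $X_{\leq i}$ denote objects in a chosen such triangle. *)

theory Defs
  imports "HOL-Computational_Algebra.Polynomial"
begin

section \<open>Linear categories\<close>

text \<open>
  The objects of a category are the elements of the type \<open>'o\<close>. All Hom-spaces are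
  subspaces of one ambient vector space \<open>'m\<close>, in general not disjoint, so that a morphism always
  has to be considered together with its source and target. Nothing is lost: a family of Hom-spaces
  embeds into its direct sum, and the composition of a linear category extends to that direct sum
  by bilinearity (the category algebra), which is why \<open>cmp\<close> needs no object indices. All axioms
  constrain \<open>cmp\<close> only on composable pairs. Full subcategories are sets of objects.
\<close>

record ('k, 'o, 'm) lin_cat =
  hom :: "'o \<Rightarrow> 'o \<Rightarrow> 'm set"
  cmp :: "'m \<Rightarrow> 'm \<Rightarrow> 'm"  (infixl \<open>\<cdot>\<index>\<close> 70)
  idn :: "'o \<Rightarrow> 'm"
  scl :: "'k \<Rightarrow> 'm \<Rightarrow> 'm"

locale linear_category =
  fixes T :: "('k::field, 'o, 'm::ab_group_add, 'z) lin_cat_scheme" (structure)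
  assumes vector_space_scl: "vector_space (scl T)"
    and subspace_hom: "module.subspace (scl T) (hom T X Y)"
    and idn_in_hom: "idn T X \<in> hom T X X"
    and cmp_in_hom: "\<lbrakk>f \<in> hom T X Y; g \<in> hom T Y Z\<rbrakk> \<Longrightarrow> g \<cdot> f \<in> hom T X Z"
    and cmp_assoc: "\<lbrakk>f \<in> hom T W X; g \<in> hom T X Y; h \<in> hom T Y Z\<rbrakk> \<Longrightarrow> (h \<cdot> g) \<cdot> f = h \<cdot> (g \<cdot> f)"
    and cmp_idn_right: "f \<in> hom T X Y \<Longrightarrow> f \<cdot> idn T X = f"
    and cmp_idn_left: "f \<in> hom T X Y \<Longrightarrow> idn T Y \<cdot> f = f"
    and cmp_add_right: "\<lbrakk>f \<in> hom T X Y; f' \<in> hom T X Y; g \<in> hom T Y Z\<rbrakk> \<Longrightarrow> g \<cdot> (f + f') = g \<cdot> f + g \<cdot> f'"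
    and cmp_add_left: "\<lbrakk>f \<in> hom T X Y; g \<in> hom T Y Z; g' \<in> hom T Y Z\<rbrakk> \<Longrightarrow> (g + g') \<cdot> f = g \<cdot> f + g' \<cdot> f"
    and cmp_scl_right: "\<lbrakk>f \<in> hom T X Y; g \<in> hom T Y Z\<rbrakk> \<Longrightarrow> g \<cdot> scl T r f = scl T r (g \<cdot> f)"
    and cmp_scl_left: "\<lbrakk>f \<in> hom T X Y; g \<in> hom T Y Z\<rbrakk> \<Longrightarrow> scl T r g \<cdot> f = scl T r (g \<cdot> f)"

definition iso_mor ::
  "('k, 'o, 'm, 'z) lin_cat_scheme \<Rightarrow> 'o \<Rightarrow> 'o \<Rightarrow> 'm \<Rightarrow> bool" where
  "iso_mor T X Y f \<longleftrightarrow>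
     f \<in> hom T X Y \<and> (\<exists>g \<in> hom T Y X. g \<cdot>\<^bsub>T\<^esub> f = idn T X \<and> f \<cdot>\<^bsub>T\<^esub> g = idn T Y)"

definition zero_obj :: "('k, 'o, 'm::ab_group_add, 'z) lin_cat_scheme \<Rightarrow> 'o \<Rightarrow> bool" where
  "zero_obj T Z \<longleftrightarrow> (\<forall>X. hom T X Z = {0} \<and> hom T Z X = {0})"

definition direct_sum ::
  "('k, 'o, 'm::ab_group_add, 'z) lin_cat_scheme \<Rightarrow> 'o \<Rightarrow> 'i set \<Rightarrow> ('i \<Rightarrow> 'o) \<Rightarrow> bool" where
  "direct_sum T X I F \<longleftrightarrow> (\<exists>inj prj.
     (\<forall>i\<in>I. inj i \<in> hom T (F i) X \<and> prj i \<in> hom T X (F i)) \<and>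
     (\<forall>i\<in>I. \<forall>j\<in>I. prj i \<cdot>\<^bsub>T\<^esub> inj j = (if i = j then idn T (F i) else 0)) \<and>
     (\<Sum>i\<in>I. inj i \<cdot>\<^bsub>T\<^esub> prj i) = idn T X)"

definition biproduct ::
  "('k, 'o, 'm::ab_group_add, 'z) lin_cat_scheme \<Rightarrow> 'o \<Rightarrow> 'o \<Rightarrow> 'o \<Rightarrow> bool" where
  "biproduct T X A B \<longleftrightarrow> direct_sum T X (UNIV :: bool set) (\<lambda>b. if b then A else B)"

locale additive_linear_category = linear_category +
  assumes ex_zero_obj: "\<exists>Z. zero_obj T Z"
    and ex_biproduct: "\<exists>X. biproduct T X A B"

definition summand_closed :: "('k, 'o, 'm::ab_group_add, 'z) lin_cat_scheme \<Rightarrow> 'o set \<Rightarrow> bool" where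
  "summand_closed T \<A> \<longleftrightarrow> (\<forall>X A B. X \<in> \<A> \<and> biproduct T X A B \<longrightarrow> A \<in> \<A>)"

definition hom_finite ::
  "('k::field, 'o, 'm::ab_group_add, 'z) lin_cat_scheme \<Rightarrow> bool" where
  "hom_finite T \<longleftrightarrow> (\<forall>X Y. \<exists>B. finite B \<and> module.span (scl T) B = hom T X Y)"

definition local_End :: "('k, 'o, 'm::ab_group_add, 'z) lin_cat_scheme \<Rightarrow> 'o \<Rightarrow> bool" where
  "local_End T X \<longleftrightarrow> idn T X \<noteq> 0 \<and>
     (\<forall>f \<in> hom T X X. \<forall>g \<in> hom T X X.
        \<not> iso_mor T X X f \<and> \<not> iso_mor T X X g \<longrightarrow> \<not> iso_mor T X X (f + g))"

definition krull_schmidt :: "('k, 'o, 'm::ab_group_add, 'z) lin_cat_scheme \<Rightarrow> bool" where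
  "krull_schmidt T \<longleftrightarrow>
     (\<forall>X. \<exists>(n::nat) F. direct_sum T X {..<n} F \<and> (\<forall>i<n. local_End T (F i)))"


section \<open>Triangulated categories\<close>

text \<open>
  The suspension is an automorphism of the category, given by \<open>sus\<close> on objects and by \<open>susm\<close>
  on morphisms (without object indices, for the same reason as \<open>cmp\<close>); \<open>tri T X Y Z f g h\<close> says that \<open>X \<rightarrow> Y \<rightarrow> Z \<rightarrow> \<Sigma>X\<close>, with maps \<open>f, g, h\<close>, is
  distinguished.
\<close>

record ('k, 'o, 'm) tri_cat = "('k, 'o, 'm) lin_cat" +
  sus :: "'o \<Rightarrow> 'o"
  susm :: "'m \<Rightarrow> 'm"
  tri :: "'o \<Rightarrow> 'o \<Rightarrow> 'o \<Rightarrow> 'm \<Rightarrow> 'm \<Rightarrow> 'm \<Rightarrow> bool"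

locale triangulated_category = additive_linear_category T
  for T :: "('k::field, 'o, 'm::ab_group_add, 'z) tri_cat_scheme" (structure) +
  assumes bij_sus: "bij (sus T)"
    and bij_susm: "bij_betw (susm T) (hom T X Y) (hom T (sus T X) (sus T Y))"
    and susm_idn: "susm T (idn T X) = idn T (sus T X)"
    and susm_cmp: "\<lbrakk>f \<in> hom T X Y; g \<in> hom T Y Z\<rbrakk> \<Longrightarrow> susm T (g \<cdot> f) = susm T g \<cdot> susm T f"
    and susm_add: "\<lbrakk>f \<in> hom T X Y; g \<in> hom T X Y\<rbrakk> \<Longrightarrow> susm T (f + g) = susm T f + susm T g"
    and susm_scl: "f \<in> hom T X Y \<Longrightarrow> susm T (scl T r f) = scl T r (susm T f)"
    and tri_in_hom: "tri T X Y Z f g h \<Longrightarrow>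
      f \<in> hom T X Y \<and> g \<in> hom T Y Z \<and> h \<in> hom T Z (sus T X)"
    and tri_iso:
      "\<lbrakk>tri T X Y Z f g h; iso_mor T X X' a; iso_mor T Y Y' b; iso_mor T Z Z' c;
        f' \<in> hom T X' Y'; g' \<in> hom T Y' Z'; h' \<in> hom T Z' (sus T X');
        b \<cdot> f = f' \<cdot> a; c \<cdot> g = g' \<cdot> b; susm T a \<cdot> h = h' \<cdot> c\<rbrakk> \<Longrightarrow> tri T X' Y' Z' f' g' h'"
    and tri_idn: "zero_obj T Z \<Longrightarrow> tri T X X Z (idn T X) 0 0"
    and tri_cone: "f \<in> hom T X Y \<Longrightarrow> \<exists>Z g h. tri T X Y Z f g h"
    and tri_rotate:
      "\<lbrakk>f \<in> hom T X Y; g \<in> hom T Y Z; h \<in> hom T Z (sus T X)\<rbrakk> \<Longrightarrow>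
        tri T X Y Z f g h \<longleftrightarrow> tri T Y Z (sus T X) g h (- susm T f)"
    and tri_fill:
      "\<lbrakk>tri T X Y Z f g h; tri T X' Y' Z' f' g' h'; a \<in> hom T X X'; b \<in> hom T Y Y';
        b \<cdot> f = f' \<cdot> a\<rbrakk> \<Longrightarrow>
        \<exists>c \<in> hom T Z Z'. c \<cdot> g = g' \<cdot> b \<and> susm T a \<cdot> h = h' \<cdot> c"
    and tri_octahedral:
      "\<lbrakk>tri T X Y A f i i'; tri T Y Z B g j j'; tri T X Z C (g \<cdot> f) l l'\<rbrakk> \<Longrightarrow>
        \<exists>u v. tri T A C B u v (susm T i \<cdot> j') \<and>
          u \<cdot> i = l \<cdot> g \<and> l' \<cdot> u = i' \<and> v \<cdot> l = j \<and> j' \<cdot> v = susm T f \<cdot> l'"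

definition shift :: "('k, 'o, 'm, 'z) tri_cat_scheme \<Rightarrow> int \<Rightarrow> 'o \<Rightarrow> 'o" where
  "shift T n X = (if n \<ge> 0 then (sus T ^^ nat n) X else (inv (sus T) ^^ nat (- n)) X)"

text \<open>The action of \<open>\<Sigma>\<^sup>n\<close> on a morphism \<open>X \<rightarrow> Y\<close>. Since \<open>susm\<close> is injective only on each single
  Hom-space, inverting it needs the source and target.\<close>

definition shiftm :: "('k, 'o, 'm, 'z) tri_cat_scheme \<Rightarrow> int \<Rightarrow> 'o \<Rightarrow> 'o \<Rightarrow> 'm \<Rightarrow> 'm" where
  "shiftm T n X Y f =
     (if n \<ge> 0 then (susm T ^^ nat n) f
      else (THE g. g \<in> hom T (shift T n X) (shift T n Y) \<and> (susm T ^^ nat (- n)) g = f))"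

definition shifts :: "('k, 'o, 'm, 'z) tri_cat_scheme \<Rightarrow> int set \<Rightarrow> 'o set \<Rightarrow> 'o set" where
  "shifts T N \<S> = {shift T n X |n X. n \<in> N \<and> X \<in> \<S>}"

definition left_perp :: "('k, 'o, 'm::ab_group_add, 'z) lin_cat_scheme \<Rightarrow> 'o set \<Rightarrow> 'o set" where
  "left_perp T \<X> = {A. \<forall>X\<in>\<X>. hom T A X = {0}}"

definition right_perp :: "('k, 'o, 'm::ab_group_add, 'z) lin_cat_scheme \<Rightarrow> 'o set \<Rightarrow> 'o set" where
  "right_perp T \<X> = {A. \<forall>X\<in>\<X>. hom T X A = {0}}"

definition star :: "('k, 'o, 'm, 'z) tri_cat_scheme \<Rightarrow> 'o set \<Rightarrow> 'o set \<Rightarrow> 'o set" where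
  "star T \<X> \<Y> = {A. \<exists>X\<in>\<X>. \<exists>Y\<in>\<Y>. \<exists>f g h. tri T X A Y f g h}"

definition torsion_pair ::
  "('k, 'o, 'm::ab_group_add, 'z) tri_cat_scheme \<Rightarrow> 'o set \<Rightarrow> 'o set \<Rightarrow> bool" where
  "torsion_pair T \<A> \<B> \<longleftrightarrow> summand_closed T \<A> \<and> summand_closed T \<B> \<and>
     (\<forall>A\<in>\<A>. \<forall>B\<in>\<B>. hom T A B = {0}) \<and> star T \<A> \<B> = UNIV"

definition co_t_structure ::
  "('k, 'o, 'm::ab_group_add, 'z) tri_cat_scheme \<Rightarrow> 'o set \<Rightarrow> 'o set \<Rightarrow> bool" where
  "co_t_structure T \<A> \<B> \<longleftrightarrow> torsion_pair T \<A> \<B> \<and> shift T (-1) ` \<A> \<subseteq> \<A>"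

definition thick_subcategory ::
  "('k, 'o, 'm::ab_group_add, 'z) tri_cat_scheme \<Rightarrow> 'o set \<Rightarrow> bool" where
  "thick_subcategory T \<P> \<longleftrightarrow>
     Collect (zero_obj T) \<subseteq> \<P> \<and>
     (\<forall>X. sus T X \<in> \<P> \<longleftrightarrow> X \<in> \<P>) \<and>
     (\<forall>X Y Z f g h. tri T X Y Z f g h \<and> X \<in> \<P> \<and> Y \<in> \<P> \<longrightarrow> Z \<in> \<P>) \<and>
     summand_closed T \<P>"

definition thick :: "('k, 'o, 'm::ab_group_add, 'z) tri_cat_scheme \<Rightarrow> 'o set \<Rightarrow> 'o set" where
  "thick T \<S> = \<Inter>{\<P>. thick_subcategory T \<P> \<and> \<S> \<subseteq> \<P>}"


section \<open>Verdier quotients\<close>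

text \<open>
  Morphisms from \<open>X\<close> to \<open>Y\<close> in the Verdier quotient by \<open>\<P>\<close> are equivalence classes of roofs
  \<open>X \<leftarrow> W \<rightarrow> Y\<close>, written \<open>(W, s, f)\<close>, whose left leg \<open>s\<close> has its cone in \<open>\<P>\<close>. Two roofs are
  equivalent if a third one dominates both. Classes are added, and multiplied by scalars, through
  representatives with a common left leg.
\<close>

definition cone_in ::
  "('k, 'o, 'm, 'z) tri_cat_scheme \<Rightarrow> 'o set \<Rightarrow> 'o \<Rightarrow> 'o \<Rightarrow> 'm \<Rightarrow> bool" where
  "cone_in T \<P> W X s \<longleftrightarrow> (\<exists>Z\<in>\<P>. \<exists>g h. tri T W X Z s g h)"

definition roofs ::
  "('k, 'o, 'm, 'z) tri_cat_scheme \<Rightarrow> 'o set \<Rightarrow> 'o \<Rightarrow> 'o \<Rightarrow> ('o \<times> 'm \<times> 'm) set" where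
  "roofs T \<P> X Y = {(W, s, f). cone_in T \<P> W X s \<and> f \<in> hom T W Y}"

definition roof_rel ::
  "('k, 'o, 'm, 'z) tri_cat_scheme \<Rightarrow> 'o set \<Rightarrow> 'o \<Rightarrow> 'o \<Rightarrow>
    (('o \<times> 'm \<times> 'm) \<times> ('o \<times> 'm \<times> 'm)) set" where
  "roof_rel T \<P> X Y = {((W, s, f), (W', s', f')).
     (W, s, f) \<in> roofs T \<P> X Y \<and> (W', s', f') \<in> roofs T \<P> X Y \<and>
     (\<exists>V. \<exists>a \<in> hom T V W. \<exists>a' \<in> hom T V W'.
        s \<cdot>\<^bsub>T\<^esub> a = s' \<cdot>\<^bsub>T\<^esub> a' \<and> f \<cdot>\<^bsub>T\<^esub> a = f' \<cdot>\<^bsub>T\<^esub> a' \<and> cone_in T \<P> V X (s \<cdot>\<^bsub>T\<^esub> a))}"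

definition verdier_hom ::
  "('k, 'o, 'm, 'z) tri_cat_scheme \<Rightarrow> 'o set \<Rightarrow> 'o \<Rightarrow> 'o \<Rightarrow> ('o \<times> 'm \<times> 'm) set set" where
  "verdier_hom T \<P> X Y = roofs T \<P> X Y // roof_rel T \<P> X Y"

definition verdier_add ::
  "('k, 'o, 'm::ab_group_add, 'z) tri_cat_scheme \<Rightarrow> 'o set \<Rightarrow> 'o \<Rightarrow> 'o \<Rightarrow>
    ('o \<times> 'm \<times> 'm) set \<Rightarrow> ('o \<times> 'm \<times> 'm) set \<Rightarrow> ('o \<times> 'm \<times> 'm) set" where
  "verdier_add T \<P> X Y \<alpha> \<beta> =
     roof_rel T \<P> X Y `` {(W, s, f + g) |W s f g. (W, s, f) \<in> \<alpha> \<and> (W, s, g) \<in> \<beta>}"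

definition verdier_scl ::
  "('k, 'o, 'm, 'z) tri_cat_scheme \<Rightarrow> 'o set \<Rightarrow> 'o \<Rightarrow> 'o \<Rightarrow>
    'k \<Rightarrow> ('o \<times> 'm \<times> 'm) set \<Rightarrow> ('o \<times> 'm \<times> 'm) set" where
  "verdier_scl T \<P> X Y c \<alpha> = roof_rel T \<P> X Y `` {(W, s, scl T c f) |W s f. (W, s, f) \<in> \<alpha>}"

definition verdier_hom_iso ::
  "('k, 'o, 'm::ab_group_add, 'z) tri_cat_scheme \<Rightarrow> 'o set \<Rightarrow> 'o \<Rightarrow> 'o \<Rightarrow> 'o \<Rightarrow> 'o \<Rightarrow> bool" where
  "verdier_hom_iso T \<P> X Y X' Y' \<longleftrightarrow> (\<exists>\<phi>.
     bij_betw \<phi> (verdier_hom T \<P> X Y) (hom T X' Y') \<and>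
     (\<forall>\<alpha> \<in> verdier_hom T \<P> X Y. \<forall>\<beta> \<in> verdier_hom T \<P> X Y.
        \<phi> (verdier_add T \<P> X Y \<alpha> \<beta>) = \<phi> \<alpha> + \<phi> \<beta>) \<and>
     (\<forall>c. \<forall>\<alpha> \<in> verdier_hom T \<P> X Y. \<phi> (verdier_scl T \<P> X Y c \<alpha>) = scl T c (\<phi> \<alpha>)))"


section \<open>Calabi--Yau triples\<close>

definition simple_minded ::
  "('k::field, 'o, 'm::ab_group_add, 'z) tri_cat_scheme \<Rightarrow> 'o set \<Rightarrow> bool" where
  "simple_minded T \<S> \<longleftrightarrow>
     (\<forall>X\<in>\<S>. \<forall>Y\<in>\<S>. \<forall>m<0. hom T X (shift T m Y) = {0}) \<and>
     (\<forall>X\<in>\<S>. \<forall>Y\<in>\<S>. vector_space.dim (scl T) (hom T X Y) = (if X = Y then 1 else 0)) \<and>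
     thick T \<S> = UNIV"

text \<open>The dual of a subspace \<open>V\<close> of \<open>'m\<close>. Functionals are extended by zero outside \<open>V\<close>, so that
  each has exactly one representative and the vector space structure is pointwise.\<close>

definition dual_space :: "('k::field \<Rightarrow> 'm::ab_group_add \<Rightarrow> 'm) \<Rightarrow> 'm set \<Rightarrow> ('m \<Rightarrow> 'k) set" where
  "dual_space s V = {\<xi>. (\<forall>u\<in>V. \<forall>v\<in>V. \<xi> (u + v) = \<xi> u + \<xi> v) \<and>
     (\<forall>c. \<forall>v\<in>V. \<xi> (s c v) = c * \<xi> v) \<and> (\<forall>v. v \<notin> V \<longrightarrow> \<xi> v = 0)}"

text \<open>Bifunctorial isomorphism \<open>D T(X, Y) \<cong> T(Y, \<Sigma>\<^sup>n X)\<close> for \<open>X\<close> in \<open>\<P>\<close> and arbitrary \<open>Y\<close>; the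
  last two conjuncts are the naturality in \<open>X\<close> and in \<open>Y\<close>.\<close>

definition relative_serre_duality ::
  "('k::field, 'o, 'm::ab_group_add, 'z) tri_cat_scheme \<Rightarrow> 'o set \<Rightarrow> int \<Rightarrow> bool" where
  "relative_serre_duality T \<P> n \<longleftrightarrow> (\<exists>\<eta>.
     (\<forall>X\<in>\<P>. \<forall>Y.
        bij_betw (\<eta> X Y) (dual_space (scl T) (hom T X Y)) (hom T Y (shift T n X)) \<and>
        (\<forall>\<xi> \<in> dual_space (scl T) (hom T X Y). \<forall>\<zeta> \<in> dual_space (scl T) (hom T X Y).
           \<eta> X Y (\<lambda>u. \<xi> u + \<zeta> u) = \<eta> X Y \<xi> + \<eta> X Y \<zeta>) \<and>
        (\<forall>c. \<forall>\<xi> \<in> dual_space (scl T) (hom T X Y).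
           \<eta> X Y (\<lambda>u. c * \<xi> u) = scl T c (\<eta> X Y \<xi>))) \<and>
     (\<forall>X\<in>\<P>. \<forall>X'\<in>\<P>. \<forall>Y. \<forall>a \<in> hom T X X'. \<forall>\<xi> \<in> dual_space (scl T) (hom T X Y).
        \<eta> X' Y (\<lambda>u. if u \<in> hom T X' Y then \<xi> (u \<cdot>\<^bsub>T\<^esub> a) else 0) =
          shiftm T n X X' a \<cdot>\<^bsub>T\<^esub> \<eta> X Y \<xi>) \<and>
     (\<forall>X\<in>\<P>. \<forall>Y Y'. \<forall>b \<in> hom T Y' Y. \<forall>\<xi> \<in> dual_space (scl T) (hom T X Y).
        \<eta> X Y' (\<lambda>u. if u \<in> hom T X Y' then \<xi> (b \<cdot>\<^bsub>T\<^esub> u) else 0) = \<eta> X Y \<xi> \<cdot>\<^bsub>T\<^esub> b))"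

text \<open>A \<open>(-d)\<close>-Calabi--Yau triple, with relative Serre functor \<open>\<Sigma>\<^sup>-\<^sup>d\<close>.\<close>

definition neg_CY_triple ::
  "('k::field, 'o, 'm::ab_group_add, 'z) tri_cat_scheme \<Rightarrow> 'o set \<Rightarrow> 'o set \<Rightarrow> int \<Rightarrow> bool" where
  "neg_CY_triple T \<P> \<S> d \<longleftrightarrow>
     (triangulated_category T \<and> hom_finite T \<and> krull_schmidt T \<and> thick_subcategory T \<P>) \<and>
     relative_serre_duality T \<P> (- d) \<and>
     (simple_minded T \<S> \<and>
      co_t_structure T (left_perp T (shifts T {0..} \<S>)) (left_perp T (shifts T {..<0} \<S>)) \<and>
      co_t_structure T (right_perp T (shifts T {0..} \<S>)) (right_perp T (shifts T {..<0} \<S>)) \<and>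
      left_perp T (shifts T {0..} \<S>) \<subseteq> \<P> \<and>
      right_perp T (shifts T {..<0} \<S>) \<subseteq> \<P>)"

definition trunc_gt ::
  "('k, 'o, 'm::ab_group_add, 'z) tri_cat_scheme \<Rightarrow> 'o set \<Rightarrow> int \<Rightarrow> 'o set" where
  "trunc_gt T \<S> i = left_perp T (shifts T {- i - 1<..} \<S>)"

definition trunc_le ::
  "('k, 'o, 'm::ab_group_add, 'z) tri_cat_scheme \<Rightarrow> 'o set \<Rightarrow> int \<Rightarrow> 'o set" where
  "trunc_le T \<S> i = left_perp T (shifts T {..<- i} \<S>)"

definition truncation_triangle ::
  "('k, 'o, 'm::ab_group_add, 'z) tri_cat_scheme \<Rightarrow> 'o set \<Rightarrow> int \<Rightarrow>
    'o \<Rightarrow> 'o \<Rightarrow> 'o \<Rightarrow> 'm \<Rightarrow> 'm \<Rightarrow> 'm \<Rightarrow> bool" where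
  "truncation_triangle T \<S> i U X V f g h \<longleftrightarrow>
     U \<in> trunc_gt T \<S> i \<and> V \<in> trunc_le T \<S> i \<and> tri T U X V f g h"

end

theory Submission
  imports Defs
begin

text \<open>
  Write \<open>A = \<Sigma>\<^sup>jY\<close>, \<open>n = j - d + 1\<close>, and let \<open>U \<rightarrow> X \<rightarrow> V \<rightarrow> \<Sigma>U\<close> be the truncation triangle, so that \<open>U\<close> is
  left orthogonal to \<open>\<Sigma>\<^sup>mS\<close> for \<open>m \<ge> n\<close> and \<open>V\<close> to \<open>\<Sigma>\<^sup>mS\<close> for \<open>m < n\<close>. The object \<open>U\<close> lies in \<open>T\<^sup>p\<close>,
  hence \<open>X\<close> and \<open>V\<close> are isomorphic in the quotient, and what has to be shown is that passing from
  \<open>T(A, V)\<close> to the quotient neither identifies nor adds morphisms.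

  The reason is that every \<open>p : A \<rightarrow> Z\<close> with \<open>Z\<close> in \<open>T\<^sup>p\<close> factors through an object \<open>Q\<close> of \<open>T\<^sup>p\<close> with
  \<open>T(Q, V) = 0 = T(\<Sigma>\<^sup>-\<^sup>1Q, V)\<close>. Consequently a morphism \<open>W \<rightarrow> A\<close> with cone in \<open>T\<^sup>p\<close> can be refined to one
  with cone such a \<open>Q\<close>, and precomposition with the refined morphism is a bijection on
  morphisms into \<open>V\<close>. The object \<open>Q\<close> is the truncation of \<open>Z\<close> with respect to the
  right-hand co-t-structure: \<open>Z\<close> is an extension of an \<open>R\<close> with \<open>T(A, R) = 0\<close> by a \<open>Q\<close> with
  \<open>T(\<Sigma>\<^sup>mS, Q) = 0\<close> for \<open>m > j\<close>. By relative Serre duality, \<open>T(Q, V)\<close> is dual to \<open>T(V, \<Sigma>\<^sup>-\<^sup>dQ)\<close>, and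
  the latter vanishes because \<open>V\<close> is left orthogonal to \<open>\<Sigma>\<^sup>mS\<close> for \<open>m < n\<close> while \<open>\<Sigma>\<^sup>-\<^sup>dQ\<close> is right
  orthogonal to \<open>\<Sigma>\<^sup>mS\<close> for \<open>m \<ge> n\<close>. The same argument applies to \<open>\<Sigma>\<^sup>-\<^sup>1Q\<close>.

  That these two orthogonals are orthogonal to each other (\<open>perp_shifts_orthogonal\<close>) is part of the fact
  that a simple minded collection determines a t-structure. Three steps lead there: an object built
  by extensions from the \<open>\<Sigma>\<^sup>mS\<close> can be rebuilt with the high shifts first (\<open>ext_closure_truncate\<close>, where
  Schur's lemma enters); the retracts of such objects form a thick subcategory (\<open>retracts_thick\<close>) and
  thus are all objects; and an object that receives no maps from the high shifts is
  a retract of the low part of an object so built.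

  The passage to roofs is \<open>verdier_hom_iso_local\<close>: a roof \<open>(W, s, u)\<close> from \<open>A\<close> to \<open>X\<close> corresponds to the
  unique \<open>t : A \<rightarrow> V\<close> such that \<open>t \<cdot> s\<close> agrees with \<open>u\<close> followed by \<open>X \<rightarrow> V\<close> after refining \<open>W\<close>.
\<close>

section \<open>Linear categories\<close>

sublocale linear_category \<subseteq> hom_space: vector_space "scl T"
  by (rule vector_space_scl)

context linear_category
begin

lemma zero_in_hom [simp]: "0 \<in> hom T X Y"
  using subspace_hom hom_space.subspace_0 by blast

lemma add_in_hom: "f \<in> hom T X Y \<Longrightarrow> g \<in> hom T X Y \<Longrightarrow> f + g \<in> hom T X Y"
  using subspace_hom hom_space.subspace_add by blast

lemma minus_in_hom: "f \<in> hom T X Y \<Longrightarrow> - f \<in> hom T X Y"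
  using subspace_hom hom_space.subspace_neg by blast

lemma diff_in_hom: "f \<in> hom T X Y \<Longrightarrow> g \<in> hom T X Y \<Longrightarrow> f - g \<in> hom T X Y"
  using subspace_hom hom_space.subspace_diff by blast

lemma scl_in_hom: "f \<in> hom T X Y \<Longrightarrow> scl T c f \<in> hom T X Y"
  using subspace_hom hom_space.subspace_scale by blast

lemma cmp_zero_right: "g \<in> hom T Y Z \<Longrightarrow> g \<cdot> 0 = 0"
  using cmp_add_right[of 0 Y Y 0 g Z] by simp

lemma cmp_zero_left: "f \<in> hom T X Y \<Longrightarrow> 0 \<cdot> f = 0"
  using cmp_add_left[of f X Y 0 Y 0] by simp

lemma cmp_minus_right: "f \<in> hom T X Y \<Longrightarrow> g \<in> hom T Y Z \<Longrightarrow> g \<cdot> (- f) = - (g \<cdot> f)"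
  using cmp_add_right[of f X Y "- f" g Z] minus_in_hom[of f X Y] cmp_zero_right[of g Y Z]
  by (simp add: eq_neg_iff_add_eq_0 add.commute)

lemma cmp_minus_left: "f \<in> hom T X Y \<Longrightarrow> g \<in> hom T Y Z \<Longrightarrow> (- g) \<cdot> f = - (g \<cdot> f)"
  using cmp_add_left[of f X Y g Z "- g"] minus_in_hom[of g Y Z] cmp_zero_left[of f X Y]
  by (simp add: eq_neg_iff_add_eq_0 add.commute)

lemma cmp_diff_right:
  "f \<in> hom T X Y \<Longrightarrow> f' \<in> hom T X Y \<Longrightarrow> g \<in> hom T Y Z \<Longrightarrow> g \<cdot> (f - f') = g \<cdot> f - g \<cdot> f'"
  using cmp_add_right[of f X Y "- f'" g Z] minus_in_hom[of f' X Y] cmp_minus_right[of f' X Y g Z]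
  by simp

lemma cmp_diff_left:
  "f \<in> hom T X Y \<Longrightarrow> g \<in> hom T Y Z \<Longrightarrow> g' \<in> hom T Y Z \<Longrightarrow> (g - g') \<cdot> f = g \<cdot> f - g' \<cdot> f"
  using cmp_add_left[of f X Y g Z "- g'"] minus_in_hom[of g' Y Z] cmp_minus_left[of f X Y g' Z]
  by simp

lemma zero_objI: "idn T Z = 0 \<Longrightarrow> zero_obj T Z"
  unfolding zero_obj_def
proof (intro allI conjI set_eqI iffI)
  fix X f
  assume Z: "idn T Z = 0"
  show "f \<in> {0}" if "f \<in> hom T X Z"
    using cmp_idn_left[OF that] cmp_zero_left[OF that] Z by simp
  show "f \<in> {0}" if "f \<in> hom T Z X"
    using cmp_idn_right[OF that] cmp_zero_right[OF that] Z by simp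
qed auto

lemma zero_obj_hom:
  assumes "zero_obj T Z"
  shows "f \<in> hom T X Z \<Longrightarrow> f = 0" "f \<in> hom T Z X \<Longrightarrow> f = 0"
  using assms unfolding zero_obj_def by auto

lemma iso_morI:
  "f \<in> hom T X Y \<Longrightarrow> g \<in> hom T Y X \<Longrightarrow> g \<cdot> f = idn T X \<Longrightarrow> f \<cdot> g = idn T Y \<Longrightarrow> iso_mor T X Y f"
  unfolding iso_mor_def by blast

lemma iso_mor_idn: "iso_mor T X X (idn T X)"
  using idn_in_hom cmp_idn_left by (blast intro: iso_morI)

lemma iso_mor_zero_obj: "iso_mor T X Y f \<Longrightarrow> zero_obj T X \<Longrightarrow> zero_obj T Y"
  unfolding iso_mor_def using zero_obj_hom by (metis cmp_zero_right zero_objI)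

end

section \<open>Triangles\<close>

context triangulated_category
begin

lemma susm_in_hom: "f \<in> hom T X Y \<Longrightarrow> susm T f \<in> hom T (sus T X) (sus T Y)"
  using bij_susm bij_betwE by blast

lemma susm_surj: "g \<in> hom T (sus T X) (sus T Y) \<Longrightarrow> \<exists>f \<in> hom T X Y. susm T f = g"
  using bij_betw_imp_surj_on[OF bij_susm, of X Y] by (metis imageE)

lemma susm_inj: "f \<in> hom T X Y \<Longrightarrow> g \<in> hom T X Y \<Longrightarrow> susm T f = susm T g \<Longrightarrow> f = g"
  using bij_susm[of X Y] unfolding bij_betw_def inj_on_def by blast

lemma susm_zero [simp]: "susm T 0 = 0"
  using susm_add[of 0 undefined undefined 0] by simp

lemma sus_surj: "\<exists>X'. sus T X' = X"
  using bij_sus unfolding bij_def surj_def by metis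

lemma sus_inj: "sus T X = sus T Y \<Longrightarrow> X = Y"
  using bij_sus unfolding bij_def inj_def by blast

lemma zero_obj_sus: "zero_obj T (sus T Z) \<longleftrightarrow> zero_obj T Z"
proof
  assume "zero_obj T Z"
  then show "zero_obj T (sus T Z)"
    using zero_obj_hom(1)[OF _ idn_in_hom] susm_idn[of Z] by (intro zero_objI) simp
next
  assume "zero_obj T (sus T Z)"
  then have "susm T (idn T Z) = susm T 0"
    using zero_obj_hom(1)[OF _ idn_in_hom] susm_idn[of Z] by simp
  then show "zero_obj T Z"
    using susm_inj[of "idn T Z" Z Z 0] idn_in_hom by (intro zero_objI) simp
qed

lemmas tri_homs = tri_in_hom[THEN conjunct1] tri_in_hom[THEN conjunct2, THEN conjunct1]
  tri_in_hom[THEN conjunct2, THEN conjunct2]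

lemma tri_rotate_right: "tri T X Y Z f g h \<Longrightarrow> tri T Y Z (sus T X) g h (- susm T f)"
  using tri_rotate tri_in_hom by blast

text \<open>
  The axiom rotates backwards only if the last map is of the form \<open>- susm T k\<close> with source a
  suspension. Both can be arranged, as \<open>\<Sigma>\<close> is an automorphism and not only an equivalence.
\<close>

lemma tri_rotate_left:
  assumes "tri T X Y Z f g h"
  shows "\<exists>Z' k. sus T Z' = Z \<and> tri T Z' X Y k f g"
proof -
  note fgh = tri_in_hom[OF assms]
  obtain Z' where Z': "sus T Z' = Z" using sus_surj by blast
  obtain k' where k': "k' \<in> hom T Z' X" "susm T k' = h"
    using susm_surj[of h Z' X] fgh Z' by auto
  have mk: "- k' \<in> hom T Z' X" using k' minus_in_hom by blast
  have "susm T (k' + - k') = susm T k' + susm T (- k')" using susm_add k'(1) mk by blast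
  then have "h = - susm T (- k')" using k'(2) by (simp add: eq_neg_iff_add_eq_0)
  then show ?thesis using tri_rotate[of "- k'" Z' X f Y g] assms fgh Z' mk by auto
qed

lemma ex_fiber: "g \<in> hom T Y Z \<Longrightarrow> \<exists>X f h. tri T X Y Z f g h"
  using tri_cone tri_rotate_left by blast

lemma tri_cmp_zero:
  assumes "tri T X Y Z f g h"
  shows "g \<cdot> f = 0" "h \<cdot> g = 0"
proof -
  have *: "g \<cdot> f = 0" if t: "tri T X Y Z f g h" for X Y Z f g h
  proof -
    obtain O' where O': "zero_obj T O'" using ex_zero_obj by blast
    note fgh = tri_in_hom[OF t]
    show ?thesis
      using tri_fill[OF tri_idn[OF O', of X] t, of "idn T X" f] idn_in_hom fgh cmp_zero_right by metis
  qed
  show "g \<cdot> f = 0" "h \<cdot> g = 0" using *[OF assms] *[OF tri_rotate_right[OF assms]] by auto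
qed

text \<open>
  The next two lemmas carry the exactness of the Hom functors. Each maps the given triangle to, or
  from, a triangle on an identity morphism and fills in.
\<close>

lemma weak_cokernel:
  assumes t: "tri T X Y Z f g h" and a: "a \<in> hom T Y W" "a \<cdot> f = 0"
  shows "\<exists>c \<in> hom T Z W. c \<cdot> g = a"
proof -
  obtain O' where O': "zero_obj T O'" using ex_zero_obj by blast
  have "tri T O' W W 0 (idn T W) 0"
    using tri_rotate[of 0 O' W "idn T W" W 0] tri_idn[of "sus T O'" W] O' zero_obj_sus idn_in_hom
    by simp
  moreover have "a \<cdot> f = 0 \<cdot> 0" using a cmp_zero_right[of 0 X O'] by simp
  ultimately obtain c where "c \<in> hom T Z W" "c \<cdot> g = idn T W \<cdot> a"
    using tri_fill[OF t, of O' W W 0 "idn T W" 0 0 a] a by auto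
  then show ?thesis using a cmp_idn_left by auto
qed

lemma weak_kernel:
  assumes t: "tri T X Y Z f g h" and a: "a \<in> hom T W Y" "g \<cdot> a = 0"
  shows "\<exists>c \<in> hom T W X. f \<cdot> c = a"
proof -
  obtain O' where O': "zero_obj T O'" using ex_zero_obj by blast
  note fgh = tri_in_hom[OF t]
  have W: "tri T W O' (sus T W) 0 0 (- idn T (sus T W))"
    using tri_rotate_right[OF tri_idn[OF O', of W]] susm_idn by simp
  have "0 \<cdot> 0 = g \<cdot> a" using a cmp_zero_right[of 0 O' Z] by simp
  then obtain c where c: "c \<in> hom T (sus T W) (sus T X)"
    "susm T a \<cdot> (- idn T (sus T W)) = (- susm T f) \<cdot> c"
    using tri_fill[OF W tri_rotate_right[OF t], of a 0] a by auto
  obtain c' where c': "c' \<in> hom T W X" "susm T c' = c" using susm_surj c by blast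
  have "susm T a = susm T f \<cdot> c"
    using c susm_in_hom[OF a(1)] susm_in_hom[of f X Y] fgh idn_in_hom cmp_idn_right
      cmp_minus_left cmp_minus_right by (metis neg_equal_iff_equal)
  also have "\<dots> = susm T (f \<cdot> c')" using susm_cmp c' fgh by auto
  finally have "a = f \<cdot> c'" using susm_inj a c' fgh cmp_in_hom by blast
  then show ?thesis using c' by blast
qed

lemma tri_hom_right_zero:
  assumes t: "tri T X Y Z f g h" and "hom T W X = {0}" "hom T W Z = {0}"
  shows "hom T W Y = {0}"
proof -
  note fgh = tri_in_hom[OF t]
  have "a = 0" if a: "a \<in> hom T W Y" for a
  proof -
    have "g \<cdot> a = 0" using cmp_in_hom a fgh assms by blast
    then obtain c where "c \<in> hom T W X" "f \<cdot> c = a" using weak_kernel[OF t a] by blast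
    then show ?thesis using assms fgh cmp_zero_right by auto
  qed
  then show ?thesis by auto
qed

lemma tri_hom_left_zero:
  assumes t: "tri T X Y Z f g h" and "hom T X W = {0}" "hom T Z W = {0}"
  shows "hom T Y W = {0}"
proof -
  note fgh = tri_in_hom[OF t]
  have "a = 0" if a: "a \<in> hom T Y W" for a
  proof -
    have "a \<cdot> f = 0" using cmp_in_hom a fgh assms by blast
    then obtain c where "c \<in> hom T Z W" "c \<cdot> g = a" using weak_cokernel[OF t a] by blast
    then show ?thesis using assms fgh cmp_zero_left by auto
  qed
  then show ?thesis by auto
qed

lemma tri_zero_obj_first:
  assumes t: "tri T X Y Z f g h" and X: "zero_obj T X"
  shows "iso_mor T Y Z g"
proof -
  note fgh = tri_in_hom[OF t]
  have f0: "f = 0" using zero_obj_hom(2)[OF X] fgh by blast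
  have h0: "h = 0" using zero_obj_hom(1)[of "sus T X"] zero_obj_sus X fgh by blast
  obtain c where c: "c \<in> hom T Z Y" "c \<cdot> g = idn T Y"
    using weak_cokernel[OF t, of "idn T Y" Y] idn_in_hom f0 cmp_zero_right by metis
  obtain e where e: "e \<in> hom T Z Y" "g \<cdot> e = idn T Z"
    using weak_kernel[OF tri_rotate_right[OF t], of "idn T Z" Z] idn_in_hom h0 cmp_zero_left by metis
  have "c = c \<cdot> (g \<cdot> e)" using e c cmp_idn_right by simp
  also have "\<dots> = (c \<cdot> g) \<cdot> e" using cmp_assoc e c fgh by metis
  also have "\<dots> = e" using c e cmp_idn_left by simp
  finally show ?thesis using iso_morI c e fgh by blast
qed

lemma tri_zero_obj_last:
  assumes t: "tri T X Y Z f g h" and Z: "zero_obj T Z"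
  shows "iso_mor T X Y f"
proof -
  obtain Z' k where Z': "sus T Z' = Z" and k: "tri T Z' X Y k f g" using tri_rotate_left[OF t] by blast
  have "zero_obj T Z'" using Z Z' zero_obj_sus[of Z'] by simp
  then show ?thesis using tri_zero_obj_first[OF k] by blast
qed

lemma tri_iso_mid:
  assumes t: "tri T X Y Z f g h" and b: "iso_mor T Y Y' b"
  shows "\<exists>f' g' h'. tri T X Y' Z f' g' h'"
proof -
  note fgh = tri_in_hom[OF t]
  obtain b' where b': "b \<in> hom T Y Y'" "b' \<in> hom T Y' Y" "b' \<cdot> b = idn T Y" "b \<cdot> b' = idn T Y'"
    using b unfolding iso_mor_def by blast
  have "tri T X Y' Z (b \<cdot> f) (g \<cdot> b') h"
  proof (rule tri_iso[OF t iso_mor_idn b iso_mor_idn])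
    show "b \<cdot> f \<in> hom T X Y'" "g \<cdot> b' \<in> hom T Y' Z" "h \<in> hom T Z (sus T X)"
      using fgh b' cmp_in_hom by blast+
    show "b \<cdot> f = b \<cdot> f \<cdot> idn T X" using fgh b' cmp_in_hom cmp_idn_right by metis
    show "idn T Z \<cdot> g = g \<cdot> b' \<cdot> b"
      using fgh b' cmp_idn_right cmp_idn_left cmp_assoc by metis
    show "susm T (idn T X) \<cdot> h = h \<cdot> idn T Z"
      using fgh susm_idn cmp_idn_left cmp_idn_right by auto
  qed
  then show ?thesis by blast
qed

lemma tri_iso_last:
  assumes t: "tri T X Y Z f g h" and c: "iso_mor T Z Z' c"
  shows "\<exists>g' h'. tri T X Y Z' f g' h'"
proof -
  note fgh = tri_in_hom[OF t]
  obtain c' where c': "c \<in> hom T Z Z'" "c' \<in> hom T Z' Z" "c' \<cdot> c = idn T Z" "c \<cdot> c' = idn T Z'"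
    using c unfolding iso_mor_def by blast
  have "tri T X Y Z' f (c \<cdot> g) (h \<cdot> c')"
  proof (rule tri_iso[OF t iso_mor_idn iso_mor_idn c])
    show "f \<in> hom T X Y" "c \<cdot> g \<in> hom T Y Z'" "h \<cdot> c' \<in> hom T Z' (sus T X)"
      using fgh c' cmp_in_hom by blast+
    show "idn T Y \<cdot> f = f \<cdot> idn T X" using fgh cmp_idn_left cmp_idn_right by auto
    show "c \<cdot> g = c \<cdot> g \<cdot> idn T Y" using fgh c' cmp_in_hom cmp_idn_right by metis
    show "susm T (idn T X) \<cdot> h = h \<cdot> c' \<cdot> c"
      using fgh c' susm_idn cmp_idn_left cmp_idn_right cmp_assoc by metis
  qed
  then show ?thesis by blast
qed

lemma tri_iso_mor:
  assumes f: "iso_mor T X Y f"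
  shows "\<exists>Z. zero_obj T Z \<and> tri T X Y Z f 0 0"
proof -
  obtain O' where O': "zero_obj T O'" using ex_zero_obj by blast
  have fh: "f \<in> hom T X Y" using f unfolding iso_mor_def by blast
  have "tri T X Y O' f 0 0"
    by (rule tri_iso[OF tri_idn[OF O'] iso_mor_idn f iso_mor_idn])
      (use fh cmp_zero_left[OF fh] cmp_zero_right[OF idn_in_hom] cmp_zero_right[of _ "O'"]
         susm_in_hom[OF idn_in_hom, of X] cmp_zero_left[OF idn_in_hom] cmp_zero_right in auto)
  then show ?thesis using O' by blast
qed

lemma iso_mor_sym: "iso_mor T X Y e \<Longrightarrow> \<exists>e'. iso_mor T Y X e'"
  unfolding iso_mor_def by blast

lemma tri_sus:
  "(\<exists>f g h. tri T (sus T X) (sus T Y) (sus T Z) f g h) \<longleftrightarrow> (\<exists>f g h. tri T X Y Z f g h)"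
proof
  assume "\<exists>f g h. tri T X Y Z f g h"
  then show "\<exists>f g h. tri T (sus T X) (sus T Y) (sus T Z) f g h"
    using tri_rotate_right by blast
next
  assume "\<exists>f g h. tri T (sus T X) (sus T Y) (sus T Z) f g h"
  then obtain f g h where t: "tri T (sus T X) (sus T Y) (sus T Z) f g h" by blast
  obtain k where k: "tri T Z (sus T X) (sus T Y) k f g"
    using tri_rotate_left[OF t] sus_inj by blast
  obtain l where l: "tri T Y Z (sus T X) l k f"
    using tri_rotate_left[OF k] sus_inj by blast
  show "\<exists>f g h. tri T X Y Z f g h"
    using tri_rotate_left[OF l] sus_inj by blast
qed

text \<open>
  If \<open>g\<close> has a section \<open>c\<close>, up to an isomorphism, then the fiber of \<open>g\<close> and the cone of \<open>c\<close> agree: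
  the octahedron on \<open>g \<cdot> c\<close> has \<open>C\<close>, a zero object and \<open>\<Sigma>B\<close> as its cones. This replaces the splitting
  of the middle term into a direct sum.
\<close>

lemma section_cone:
  assumes t: "tri T B X A f g h" and t': "tri T A' X C c p q" and iso: "iso_mor T A' A (g \<cdot> c)"
  shows "\<exists>e. iso_mor T B C e"
proof -
  obtain O' where O': "zero_obj T O'" "tri T A' A O' (g \<cdot> c) 0 0" using tri_iso_mor[OF iso] by blast
  obtain u v w where "tri T C O' (sus T B) u v w"
    using tri_octahedral[OF t' tri_rotate_right[OF t] O'(2)] by blast
  then obtain B' k where "sus T B' = sus T B" "tri T B' C O' k u v" using tri_rotate_left by blast
  then show ?thesis using tri_zero_obj_last O' sus_inj by blast
qed


lemma iso_mor_susm:
  assumes f: "f \<in> hom T X Y"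
  shows "iso_mor T (sus T X) (sus T Y) (susm T f) \<longleftrightarrow> iso_mor T X Y f"
proof
  assume "iso_mor T X Y f"
  then obtain g where g: "g \<in> hom T Y X" "g \<cdot> f = idn T X" "f \<cdot> g = idn T Y"
    unfolding iso_mor_def by blast
  then show "iso_mor T (sus T X) (sus T Y) (susm T f)"
    using susm_cmp[OF f g(1)] susm_cmp[OF g(1) f] susm_idn
    by (intro iso_morI[OF susm_in_hom[OF f] susm_in_hom[OF g(1)]]) simp_all
next
  assume "iso_mor T (sus T X) (sus T Y) (susm T f)"
  then obtain g' where g': "g' \<in> hom T (sus T Y) (sus T X)"
      "g' \<cdot> susm T f = idn T (sus T X)" "susm T f \<cdot> g' = idn T (sus T Y)"
    unfolding iso_mor_def by blast
  obtain g where g: "g \<in> hom T Y X" "susm T g = g'" using susm_surj[OF g'(1)] by blast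
  have "g \<cdot> f = idn T X"
    using susm_inj[OF cmp_in_hom[OF f g(1)] idn_in_hom] susm_cmp[OF f g(1)] g(2) g'(2) susm_idn by simp
  moreover have "f \<cdot> g = idn T Y"
    using susm_inj[OF cmp_in_hom[OF g(1) f] idn_in_hom] susm_cmp[OF g(1) f] g(2) g'(3) susm_idn by simp
  ultimately show "iso_mor T X Y f" using iso_morI[OF f g(1)] by blast
qed

lemma fiber_unique:
  assumes t: "tri T X Y Z f g h" and t': "tri T X' Y Z f' g h'"
  shows "\<exists>e. iso_mor T X X' e"
proof -
  obtain O' where O': "zero_obj T O'" using ex_zero_obj by blast
  have g: "g \<cdot> idn T Y = g" using tri_homs(2)[OF t'] cmp_idn_right by blast
  obtain u v w where uvw: "tri T O' (sus T X) (sus T X') u v w"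
    using tri_octahedral[OF tri_idn[OF O'] tri_rotate_right[OF t'], of "sus T X" h "- susm T f"]
      tri_rotate_right[OF t] g by auto
  obtain e where e: "iso_mor T (sus T X) (sus T X') e" using tri_zero_obj_first[OF uvw O'] by blast
  then obtain e' where "e' \<in> hom T X X'" "susm T e' = e"
    using susm_surj[of e X X'] unfolding iso_mor_def by blast
  then show ?thesis using e iso_mor_susm by blast
qed

text \<open>
  Associativity of extensions: \<open>X\<close> filtered with factors \<open>B\<close> and then \<open>A\<close>, \<open>C\<close> (grouped as \<open>X'\<close>) is
  also the extension of \<open>C\<close> by some \<open>Y\<close> with factors \<open>B\<close>, \<open>A\<close>. The octahedron on \<open>g' \<cdot> g\<close> yields the
  suspension of the second triangle.
\<close>

lemma octahedral_fibers:
  assumes t: "tri T B X X' f g h" and t': "tri T A X' C f' g' h'"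
  shows "\<exists>Y k l a b c. tri T Y X C k (g' \<cdot> g) l \<and> tri T B Y A a b c"
proof -
  note fgh = tri_in_hom[OF t] tri_in_hom[OF t']
  obtain Y k l where Y: "tri T Y X C k (g' \<cdot> g) l"
    using ex_fiber[of "g' \<cdot> g" X C] fgh cmp_in_hom by blast
  obtain u v w where "tri T (sus T B) (sus T Y) (sus T A) u v w"
    using tri_octahedral[OF tri_rotate_right[OF t] tri_rotate_right[OF t'] tri_rotate_right[OF Y]]
    by blast
  then have "\<exists>a b c. tri T B Y A a b c" using tri_sus[of B Y A] by blast
  then show ?thesis using Y by blast
qed

end

section \<open>Shifts and orthogonals\<close>

context triangulated_category
begin

lemma shift_0 [simp]: "shift T 0 X = X"
  by (simp add: shift_def)

lemma sus_shift: "sus T (shift T n X) = shift T (n + 1) X"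
proof -
  have inv: "sus T (inv (sus T) Z) = Z" for Z
    using bij_sus by (simp add: bij_is_surj surj_f_inv_f)
  consider "n \<ge> 0" | "n = -1" | "n < -1" by linarith
  then show ?thesis
  proof cases
    case 1
    then have "nat (n + 1) = Suc (nat n)" by simp
    with 1 show ?thesis by (simp add: shift_def)
  next
    case 2
    then show ?thesis by (simp add: shift_def inv)
  next
    case 3
    then have "nat (- n) = Suc (nat (- (n + 1)))" by simp
    with 3 show ?thesis by (simp add: shift_def inv)
  qed
qed

lemma shift_add: "shift T a (shift T b X) = shift T (a + b) X"
proof (induction a rule: int_induct[of _ 0])
  case (step1 i)
  then show ?case using sus_shift[of i "shift T b X"] sus_shift[of "i + b" X] by (simp add: algebra_simps)
next
  case (step2 i)
  then have "sus T (shift T (i - 1) (shift T b X)) = sus T (shift T (i - 1 + b) X)"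
    using sus_shift[of "i - 1" "shift T b X"] sus_shift[of "i - 1 + b" X] by (simp add: algebra_simps)
  then show ?case using sus_inj by blast
qed simp

text \<open>
  Reduces statements about all powers of \<open>\<Sigma>\<close>, negative ones included, to \<open>\<Sigma>\<close> itself.
\<close>

lemma shift_invariant:
  assumes "\<And>X Y Z. Q (sus T X) (sus T Y) (sus T Z) \<longleftrightarrow> Q X Y Z"
  shows "Q (shift T n X) (shift T n Y) (shift T n Z) \<longleftrightarrow> Q X Y Z"
proof (induction n rule: int_induct[of _ 0])
  case (step1 i)
  then show ?case using assms[of "shift T i X" "shift T i Y" "shift T i Z"] by (simp add: sus_shift)
next
  case (step2 i)
  then show ?case
    using assms[of "shift T (i - 1) X" "shift T (i - 1) Y" "shift T (i - 1) Z"] by (simp add: sus_shift)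
qed simp

lemma hom_zero_sus: "hom T (sus T X) (sus T Y) = {0} \<longleftrightarrow> hom T X Y = {0}"
proof
  assume "hom T (sus T X) (sus T Y) = {0}"
  then have "f = 0" if "f \<in> hom T X Y" for f
    using susm_in_hom[OF that] susm_inj[OF that, of 0] by simp
  then show "hom T X Y = {0}" by auto
next
  assume "hom T X Y = {0}"
  then have "g = 0" if "g \<in> hom T (sus T X) (sus T Y)" for g
    using susm_surj[OF that] by auto
  then show "hom T (sus T X) (sus T Y) = {0}" by auto
qed

lemma hom_zero_shift: "hom T (shift T n X) (shift T n Y) = {0} \<longleftrightarrow> hom T X Y = {0}"
  by (rule shift_invariant[of "\<lambda>X Y _. hom T X Y = {0}"]) (rule hom_zero_sus)

lemma hom_zero_shift_left: "hom T (shift T n X) Y = {0} \<longleftrightarrow> hom T X (shift T (- n) Y) = {0}"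
  using hom_zero_shift[of n X "shift T (- n) Y"] by (simp add: shift_add)

lemma hom_zero_shift_right: "hom T X (shift T n Y) = {0} \<longleftrightarrow> hom T (shift T (- n) X) Y = {0}"
  using hom_zero_shift_left[of "- n" X Y] by simp

lemma tri_shift:
  "(\<exists>f g h. tri T (shift T n X) (shift T n Y) (shift T n Z) f g h) \<longleftrightarrow> (\<exists>f g h. tri T X Y Z f g h)"
  by (rule shift_invariant[of "\<lambda>X Y Z. \<exists>f g h. tri T X Y Z f g h"]) (rule tri_sus)

lemma thick_shift:
  assumes "thick_subcategory T \<P>"
  shows "shift T n X \<in> \<P> \<longleftrightarrow> X \<in> \<P>"
proof -
  have "\<forall>X. sus T X \<in> \<P> \<longleftrightarrow> X \<in> \<P>" using assms unfolding thick_subcategory_def by (elim conjE)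
  then show ?thesis using shift_invariant[of "\<lambda>X _ _. X \<in> \<P>"] by blast
qed

lemma left_perp_shifts:
  "X \<in> left_perp T (shifts T N \<S>) \<longleftrightarrow> (\<forall>n\<in>N. \<forall>s\<in>\<S>. hom T X (shift T n s) = {0})"
  unfolding left_perp_def shifts_def by auto

lemma right_perp_shifts:
  "X \<in> right_perp T (shifts T N \<S>) \<longleftrightarrow> (\<forall>n\<in>N. \<forall>s\<in>\<S>. hom T (shift T n s) X = {0})"
  unfolding right_perp_def shifts_def by auto

lemma shift_in_left_perp:
  "shift T m X \<in> left_perp T (shifts T N \<S>) \<longleftrightarrow> X \<in> left_perp T (shifts T ((\<lambda>n. n - m) ` N) \<S>)"
  unfolding left_perp_shifts hom_zero_shift_left by (simp add: shift_add)

lemma shift_in_right_perp: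
  "shift T m X \<in> right_perp T (shifts T N \<S>) \<longleftrightarrow> X \<in> right_perp T (shifts T ((\<lambda>n. n - m) ` N) \<S>)"
  unfolding right_perp_shifts hom_zero_shift_right by (simp add: shift_add)

end

section \<open>Extension closures and retracts\<close>

context triangulated_category
begin

text \<open>
  Only extensions by a generator on the left are rules, so that objects can be treated by induction
  on the number of generators. Closure under arbitrary extensions is \<open>ext_closure_tri\<close>.
\<close>

inductive_set ext_closure :: "'o set \<Rightarrow> 'o set" for \<C> where
  zero: "zero_obj T X \<Longrightarrow> X \<in> ext_closure \<C>"
| extend: "s \<in> \<C> \<Longrightarrow> tri T s X X' f g h \<Longrightarrow> X' \<in> ext_closure \<C> \<Longrightarrow> X \<in> ext_closure \<C>"

lemma ext_closure_iso:
  assumes "X \<in> ext_closure \<C>" and e: "iso_mor T X Y e"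
  shows "Y \<in> ext_closure \<C>"
  using assms(1)
proof (cases rule: ext_closure.cases)
  case zero
  then show ?thesis using iso_mor_zero_obj e ext_closure.zero by blast
next
  case (extend s X' f g h)
  then show ?thesis using tri_iso_mid[OF extend(2) e] ext_closure.extend by blast
qed

lemma ext_closure_tri: "A \<in> ext_closure \<C> \<Longrightarrow> tri T A X B f g h \<Longrightarrow> B \<in> ext_closure \<C> \<Longrightarrow> X \<in> ext_closure \<C>"
proof (induction A arbitrary: X B f g h rule: ext_closure.induct)
  case (zero A)
  then show ?case using tri_zero_obj_first ext_closure_iso iso_mor_sym by metis
next
  case (extend s A A' a b c)
  obtain C l l' where C: "tri T s X C (f \<cdot> a) l l'"
    using tri_cone cmp_in_hom tri_in_hom extend by metis
  obtain u v w where "tri T A' C B u v w"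
    using tri_octahedral[OF extend.hyps(2) extend.prems(1) C] by blast
  then show ?case using extend C ext_closure.extend by blast
qed

lemma ext_closure_left_zero: "A \<in> ext_closure \<C> \<Longrightarrow> (\<And>s. s \<in> \<C> \<Longrightarrow> hom T s N = {0}) \<Longrightarrow> hom T A N = {0}"
proof (induction A rule: ext_closure.induct)
  case (zero X)
  then show ?case by (simp add: zero_obj_def)
next
  case (extend s X X' f g h)
  then show ?case using tri_hom_left_zero by blast
qed

lemma ext_closure_right_zero: "A \<in> ext_closure \<C> \<Longrightarrow> (\<And>s. s \<in> \<C> \<Longrightarrow> hom T M s = {0}) \<Longrightarrow> hom T M A = {0}"
proof (induction A rule: ext_closure.induct)
  case (zero X)
  then show ?case by (simp add: zero_obj_def)
next
  case (extend s X X' f g h)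
  then show ?case using tri_hom_right_zero by blast
qed

lemma ext_closure_sus:
  assumes C: "\<And>s. sus T s \<in> \<C> \<longleftrightarrow> s \<in> \<C>"
  shows "sus T X \<in> ext_closure \<C> \<longleftrightarrow> X \<in> ext_closure \<C>"
proof
  show "sus T X \<in> ext_closure \<C> \<Longrightarrow> X \<in> ext_closure \<C>"
  proof (induction "sus T X" arbitrary: X rule: ext_closure.induct)
    case zero
    then show ?case using zero_obj_sus ext_closure.zero by blast
  next
    case (extend s X' f g h)
    obtain s0 X0 where e: "s = sus T s0" "X' = sus T X0" using sus_surj by metis
    then obtain a b c where "tri T s0 X X0 a b c" using extend tri_sus[of s0 X X0] by blast
    then show ?case using extend C e ext_closure.extend[of s0] by blast
  qed
next
  show "X \<in> ext_closure \<C> \<Longrightarrow> sus T X \<in> ext_closure \<C>"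
  proof (induction X rule: ext_closure.induct)
    case (zero X)
    then show ?case using zero_obj_sus ext_closure.zero by blast
  next
    case (extend s X X' f g h)
    then obtain a b c where "tri T (sus T s) (sus T X) (sus T X') a b c" using tri_sus by blast
    then show ?case using extend C ext_closure.extend[of "sus T s"] by blast
  qed
qed

text \<open>
  Retracts rather than direct summands, since no complement has to be carried through the arguments.
\<close>

definition retracts :: "'o set \<Rightarrow> 'o set" where
  "retracts \<C> = {X. \<exists>E\<in>\<C>. \<exists>i\<in>hom T X E. \<exists>p\<in>hom T E X. p \<cdot> i = idn T X}"

lemma retracts_sus:
  assumes C: "\<And>X. sus T X \<in> \<C> \<longleftrightarrow> X \<in> \<C>"
  shows "sus T X \<in> retracts \<C> \<longleftrightarrow> X \<in> retracts \<C>"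
proof
  assume "sus T X \<in> retracts \<C>"
  then obtain E' i' p' where e': "E' \<in> \<C>" "i' \<in> hom T (sus T X) E'" "p' \<in> hom T E' (sus T X)"
    "p' \<cdot> i' = idn T (sus T X)"
    unfolding retracts_def by blast
  obtain E where E: "sus T E = E'" using sus_surj by blast
  obtain i p where ip: "i \<in> hom T X E" "susm T i = i'" "p \<in> hom T E X" "susm T p = p'"
    using susm_surj e' E by metis
  have "susm T (p \<cdot> i) = susm T (idn T X)" using susm_cmp ip e' susm_idn by metis
  then have "p \<cdot> i = idn T X" using susm_inj ip cmp_in_hom idn_in_hom by blast
  then show "X \<in> retracts \<C>" using e' E C ip unfolding retracts_def by blast
next
  assume "X \<in> retracts \<C>"
  then obtain E i p where E: "E \<in> \<C>" "i \<in> hom T X E" "p \<in> hom T E X" "p \<cdot> i = idn T X"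
    unfolding retracts_def by blast
  then have "susm T p \<cdot> susm T i = idn T (sus T X)" using susm_cmp[OF E(2,3)] susm_idn by simp
  moreover have "sus T E \<in> \<C>" using C E(1) by blast
  ultimately show "sus T X \<in> retracts \<C>"
    unfolding retracts_def using susm_in_hom[OF E(2)] susm_in_hom[OF E(3)] by blast
qed

text \<open>
  The morphism \<open>f\<close> is a retract of \<open>f' = i2 \<cdot> (f \<cdot> p1)\<close>. Filling in gives \<open>i3\<close> and \<open>p3\<close> between the cones,
  but \<open>c = p3 \<cdot> i3\<close> is merely an endomorphism of \<open>Z\<close> compatible with the identities on \<open>X\<close> and \<open>Y\<close>.
  Then \<open>(c - 1) \<cdot> g = 0\<close> and \<open>h \<cdot> (c - 1) = 0\<close>, so \<open>c - 1\<close> factors through \<open>h\<close> and has square zero. Hence \<open>c\<close> is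
  invertible, with inverse \<open>2 - c\<close>, and correcting \<open>p3\<close> by this inverse exhibits \<open>Z\<close> as a retract.
\<close>

lemma retracts_tri:
  assumes C: "\<And>X Y Z f g h. tri T X Y Z f g h \<Longrightarrow> X \<in> \<C> \<Longrightarrow> Y \<in> \<C> \<Longrightarrow> Z \<in> \<C>"
    and t: "tri T X Y Z f g h" and "X \<in> retracts \<C>" "Y \<in> retracts \<C>"
  shows "Z \<in> retracts \<C>"
proof -
  note fgh = tri_homs[OF t]
  obtain E1 i1 p1 where 1: "E1 \<in> \<C>" "i1 \<in> hom T X E1" "p1 \<in> hom T E1 X" "p1 \<cdot> i1 = idn T X"
    using assms unfolding retracts_def by blast
  obtain E2 i2 p2 where 2: "E2 \<in> \<C>" "i2 \<in> hom T Y E2" "p2 \<in> hom T E2 Y" "p2 \<cdot> i2 = idn T Y"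
    using assms unfolding retracts_def by blast
  define f' where "f' = i2 \<cdot> (f \<cdot> p1)"
  have fp: "f \<cdot> p1 \<in> hom T E1 Y" using cmp_in_hom[OF 1(3) fgh(1)] .
  have f': "f' \<in> hom T E1 E2" using cmp_in_hom[OF fp 2(2)] f'_def by simp
  obtain E3 g' h' where t': "tri T E1 E2 E3 f' g' h'" using tri_cone f' by blast
  have 3: "E3 \<in> \<C>" using C[OF t' 1(1) 2(1)] .
  note fgh' = tri_homs[OF t']
  have "i2 \<cdot> f = f' \<cdot> i1"
  proof -
    have "f' \<cdot> i1 = i2 \<cdot> ((f \<cdot> p1) \<cdot> i1)" unfolding f'_def using cmp_assoc[OF 1(2) fp 2(2)] by simp
    also have "(f \<cdot> p1) \<cdot> i1 = f" using cmp_assoc[OF 1(2,3) fgh(1)] 1(4) cmp_idn_right[OF fgh(1)] by simp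
    finally show ?thesis by simp
  qed
  then obtain i3 where i3: "i3 \<in> hom T Z E3" "i3 \<cdot> g = g' \<cdot> i2" "susm T i1 \<cdot> h = h' \<cdot> i3"
    using tri_fill[OF t t' 1(2) 2(2)] by blast
  have "p2 \<cdot> f' = f \<cdot> p1" unfolding f'_def using cmp_assoc[OF fp 2(2,3)] 2 cmp_idn_left[OF fp] by simp
  then obtain p3 where p3: "p3 \<in> hom T E3 Z" "p3 \<cdot> g' = g \<cdot> p2" "susm T p1 \<cdot> h' = h \<cdot> p3"
    using tri_fill[OF t' t 1(3) 2(3)] by blast
  define c where "c = p3 \<cdot> i3"
  have c: "c \<in> hom T Z Z" unfolding c_def using cmp_in_hom[OF i3(1) p3(1)] .
  have cg: "c \<cdot> g = g"
  proof -
    have "c \<cdot> g = (p3 \<cdot> g') \<cdot> i2"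
      unfolding c_def using cmp_assoc[OF fgh(2) i3(1) p3(1)] cmp_assoc[OF 2(2) fgh'(2) p3(1)] i3(2) by simp
    also have "\<dots> = g" using cmp_assoc[OF 2(2,3) fgh(2)] p3(2) 2(4) cmp_idn_right[OF fgh(2)] by simp
    finally show ?thesis .
  qed
  have hc: "h \<cdot> c = h"
  proof -
    have "h \<cdot> c = (susm T p1 \<cdot> h') \<cdot> i3" unfolding c_def using cmp_assoc[OF i3(1) p3(1) fgh(3)] p3(3) by simp
    also have "\<dots> = susm T p1 \<cdot> (susm T i1 \<cdot> h)" using cmp_assoc[OF i3(1) fgh'(3) susm_in_hom[OF 1(3)]] i3(3) by simp
    also have "\<dots> = susm T (p1 \<cdot> i1) \<cdot> h" using cmp_assoc[OF fgh(3) susm_in_hom[OF 1(2)] susm_in_hom[OF 1(3)]] susm_cmp[OF 1(2,3)] by simp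
    finally show ?thesis using 1(4) susm_idn cmp_idn_left[OF fgh(3)] by simp
  qed
  define e where "e = c - idn T Z"
  have e: "e \<in> hom T Z Z" unfolding e_def using c idn_in_hom diff_in_hom by blast
  have "e \<cdot> g = 0" unfolding e_def using cmp_diff_left[OF fgh(2) c idn_in_hom] cg cmp_idn_left[OF fgh(2)] by simp
  then obtain e' where e': "e' \<in> hom T (sus T X) Z" "e = e' \<cdot> h"
    using weak_cokernel[OF tri_rotate_right[OF t] e] by blast
  have "h \<cdot> e = 0" unfolding e_def using cmp_diff_right[OF c idn_in_hom fgh(3)] hc cmp_idn_right[OF fgh(3)] by simp
  then have ee: "e \<cdot> e = 0" using e'(2) cmp_assoc[OF e fgh(3) e'(1)] cmp_zero_right[OF e'(1)] by simp
  have k: "idn T Z - e \<in> hom T Z Z" using e idn_in_hom diff_in_hom by blast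
  have "(idn T Z - e) \<cdot> c = (idn T Z - e) \<cdot> (idn T Z + e)" unfolding e_def by simp
  also have "\<dots> = (idn T Z - e) + (idn T Z - e) \<cdot> e"
    using cmp_add_right[OF idn_in_hom e k] cmp_idn_right[OF k] by simp
  also have "(idn T Z - e) \<cdot> e = e"
    using cmp_diff_left[OF e idn_in_hom e] cmp_idn_left[OF e] ee by simp
  finally have "(idn T Z - e) \<cdot> c = idn T Z" by simp
  then have "((idn T Z - e) \<cdot> p3) \<cdot> i3 = idn T Z"
    unfolding c_def using cmp_assoc[OF i3(1) p3(1) k] by simp
  moreover have "(idn T Z - e) \<cdot> p3 \<in> hom T E3 Z" using cmp_in_hom[OF p3(1) k] .
  ultimately show ?thesis unfolding retracts_def using 3 i3(1) by blast
qed

lemma retracts_thick: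
  assumes "\<And>X. zero_obj T X \<Longrightarrow> X \<in> \<C>" and "\<And>X. sus T X \<in> \<C> \<longleftrightarrow> X \<in> \<C>"
    and "\<And>X Y Z f g h. tri T X Y Z f g h \<Longrightarrow> X \<in> \<C> \<Longrightarrow> Y \<in> \<C> \<Longrightarrow> Z \<in> \<C>"
  shows "thick_subcategory T (retracts \<C>)" "\<C> \<subseteq> retracts \<C>"
proof -
  show sub: "\<C> \<subseteq> retracts \<C>"
    unfolding retracts_def using idn_in_hom cmp_idn_left by blast
  have "A \<in> retracts \<C>" if X: "X \<in> retracts \<C>" and XAB: "biproduct T X A B" for X A B
  proof -
    obtain E i p where E: "E \<in> \<C>" "i \<in> hom T X E" "p \<in> hom T E X" "p \<cdot> i = idn T X"
      using X unfolding retracts_def by blast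
    obtain inj prj where
      d: "\<forall>b\<in>(UNIV :: bool set). inj b \<in> hom T (if b then A else B) X \<and> prj b \<in> hom T X (if b then A else B)"
         "\<forall>b\<in>(UNIV :: bool set). \<forall>c\<in>UNIV. prj b \<cdot> inj c = (if b = c then idn T (if b then A else B) else 0)"
      using XAB unfolding biproduct_def direct_sum_def by blast
    have A: "inj True \<in> hom T A X" "prj True \<in> hom T X A" "prj True \<cdot> inj True = idn T A"
      using bspec[OF d(1), of True] d(2) by auto
    have "(prj True \<cdot> p) \<cdot> (i \<cdot> inj True) = prj True \<cdot> (p \<cdot> (i \<cdot> inj True))"
      using cmp_assoc[OF cmp_in_hom[OF A(1) E(2)] E(3) A(2)] by simp
    also have "p \<cdot> (i \<cdot> inj True) = inj True" using cmp_assoc[OF A(1) E(2,3)] A E cmp_idn_left[OF A(1)] by simp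
    finally have "(prj True \<cdot> p) \<cdot> (i \<cdot> inj True) = idn T A" using A by simp
    then show ?thesis
      unfolding retracts_def using E(1) cmp_in_hom[OF A(1) E(2)] cmp_in_hom[OF E(3) A(2)] by blast
  qed
  moreover have "Z \<in> retracts \<C>"
    if "tri T X Y Z f g h" "X \<in> retracts \<C>" "Y \<in> retracts \<C>" for X Y Z f g h
    by (rule retracts_tri[OF assms(3) that])
  ultimately show "thick_subcategory T (retracts \<C>)"
    unfolding thick_subcategory_def summand_closed_def
    using sub assms(1) retracts_sus[OF assms(2)] by blast
qed

end

section \<open>Simple minded collections\<close>

context triangulated_category
begin

lemma nonzero_iso_sus:
  "(\<forall>f \<in> hom T (sus T X) (sus T Y). f \<noteq> 0 \<longrightarrow> iso_mor T (sus T X) (sus T Y) f) \<longleftrightarrow>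
   (\<forall>f \<in> hom T X Y. f \<noteq> 0 \<longrightarrow> iso_mor T X Y f)" (is "?L \<longleftrightarrow> ?R")
proof
  assume L: ?L
  show ?R
  proof (intro ballI impI)
    fix f assume f: "f \<in> hom T X Y" "f \<noteq> 0"
    then have "susm T f \<noteq> 0" using susm_inj[OF f(1), of 0] by auto
    then show "iso_mor T X Y f" using L susm_in_hom[OF f(1)] iso_mor_susm[OF f(1)] by blast
  qed
next
  assume R: ?R
  show ?L
  proof (intro ballI impI)
    fix g assume g: "g \<in> hom T (sus T X) (sus T Y)" "g \<noteq> 0"
    obtain f where f: "f \<in> hom T X Y" "susm T f = g" using susm_surj[OF g(1)] by blast
    then have "f \<noteq> 0" using g(2) by auto
    then show "iso_mor T (sus T X) (sus T Y) g" using R f iso_mor_susm[OF f(1)] by blast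
  qed
qed

lemma nonzero_iso_shift:
  "(\<forall>f \<in> hom T (shift T n X) (shift T n Y). f \<noteq> 0 \<longrightarrow> iso_mor T (shift T n X) (shift T n Y) f) \<longleftrightarrow>
   (\<forall>f \<in> hom T X Y. f \<noteq> 0 \<longrightarrow> iso_mor T X Y f)"
  by (rule shift_invariant[of "\<lambda>X Y _. \<forall>f \<in> hom T X Y. f \<noteq> 0 \<longrightarrow> iso_mor T X Y f"])
    (rule nonzero_iso_sus)

text \<open>
  Schur's lemma. Finite-dimensionality rules out that dimension \<open>0\<close>, the cardinality of an
  infinite basis, is reported for a nonzero Hom-space.
\<close>

lemma simple_minded_nonzero_iso:
  assumes fin: "hom_finite T" and smc: "simple_minded T \<S>"
    and "s \<in> \<S>" "s' \<in> \<S>" and f: "f \<in> hom T s s'" "f \<noteq> 0"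
  shows "iso_mor T s s' f"
proof -
  have dim: "hom_space.dim (hom T s s') = (if s = s' then 1 else 0)"
    using smc assms(3,4) unfolding simple_minded_def by blast
  obtain B where B: "B \<subseteq> hom T s s'" "hom_space.independent B" "hom T s s' \<subseteq> hom_space.span B"
    "card B = hom_space.dim (hom T s s')"
    using hom_space.basis_exists by blast
  obtain B' where "finite B'" "hom_space.span B' = hom T s s'" using fin unfolding hom_finite_def by blast
  then have finB: "finite B" using hom_space.independent_span_bound[of B' B] B(1,2) by simp
  have ss': "s = s'"
  proof (rule ccontr)
    assume "s \<noteq> s'"
    then have "B = {}" using dim B(4) finB by simp
    then show False using B(3) f by auto
  qed
  then have "card B = 1" using dim B(4) by simp
  then obtain b where b: "B = {b}" by (auto simp: card_1_singleton_iff)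
  obtain c r where cr: "f = scl T c b" "idn T s = scl T r b"
    using B(3) f(1) idn_in_hom[of s] ss' unfolding b hom_space.span_singleton by blast
  have r: "r \<noteq> 0"
  proof
    assume "r = 0"
    then have "f = f \<cdot> 0" using cr(2) cmp_idn_right[OF f(1)] by simp
    then show False using cmp_zero_right[OF f(1)] f(2) by simp
  qed
  have c: "c \<noteq> 0" using cr(1) f(2) by auto
  have b': "b \<in> hom T s s" using B(1) b ss' by blast
  have fi: "f = scl T (c / r) (idn T s)" using cr r by simp
  have g: "scl T (r / c) (idn T s) \<in> hom T s s" using idn_in_hom scl_in_hom by blast
  have f': "f \<in> hom T s s" using f ss' by simp
  have "scl T (r / c) (idn T s) \<cdot> f = scl T (r / c) f"
    using cmp_scl_left[OF f' idn_in_hom] cmp_idn_left[OF f'] by simp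
  moreover have "f \<cdot> scl T (r / c) (idn T s) = scl T (r / c) f"
    using cmp_scl_right[OF idn_in_hom f'] cmp_idn_right[OF f'] by simp
  moreover have "scl T (r / c) f = idn T s" using fi r c by simp
  ultimately show ?thesis using iso_morI[OF f' g] ss' by simp
qed

context
  fixes \<S> :: "'o set"
  assumes neg_hom: "\<And>s s' m. s \<in> \<S> \<Longrightarrow> s' \<in> \<S> \<Longrightarrow> m < 0 \<Longrightarrow> hom T s (shift T m s') = {0}"
    and nonzero_iso: "\<And>s s' f. s \<in> \<S> \<Longrightarrow> s' \<in> \<S> \<Longrightarrow> f \<in> hom T s s' \<Longrightarrow> f \<noteq> 0 \<Longrightarrow> iso_mor T s s' f"
begin

lemma shifts_hom_zero:
  "s \<in> \<S> \<Longrightarrow> s' \<in> \<S> \<Longrightarrow> n < m \<Longrightarrow> hom T (shift T m s) (shift T n s') = {0}"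
  using hom_zero_shift_left[of m s "shift T n s'"] neg_hom[of s s' "- m + n"] by (simp add: shift_add)

text \<open>
  This says that \<open>\<Sigma>\<^sup>ns\<close> behaves like a simple object: a nonzero map onto it from an
  object with factors in degrees at least \<open>n\<close> has its fiber among such objects. In the induction,
  consider the restriction of \<open>q\<close> to the first factor \<open>t\<close>. If it is nonzero, it is an isomorphism by
  Schur's lemma, so \<open>t\<close> splits off and the fiber is the remaining part \<open>A'\<close>. If it is zero, \<open>q\<close>
  comes from \<open>A'\<close>, and the fiber is an extension of the fiber on \<open>A'\<close> by \<open>t\<close>.
\<close>

lemma ext_closure_fiber:
  "A \<in> ext_closure (shifts T {n..} \<S>) \<Longrightarrow> tri T X A (shift T n s) p q h \<Longrightarrow> s \<in> \<S> \<Longrightarrow> q \<noteq> 0 \<Longrightarrow>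
    X \<in> ext_closure (shifts T {n..} \<S>)"
proof (induction A arbitrary: X p q h rule: ext_closure.induct)
  case (zero A)
  then show ?case using zero_obj_hom(2)[OF zero.hyps tri_homs(2)[OF zero.prems(1)]] by simp
next
  case (extend t A A' i r k)
  obtain m s' where t: "t = shift T m s'" "n \<le> m" "s' \<in> \<S>"
    using extend.hyps(1) unfolding shifts_def by auto
  note q = tri_homs(2)[OF extend.prems(1)] and i = tri_homs(1)[OF extend.hyps(2)]
    and r = tri_homs(2)[OF extend.hyps(2)]
  have qi: "q \<cdot> i \<in> hom T t (shift T n s)" using cmp_in_hom[OF i q] .
  show ?case
  proof (cases "q \<cdot> i = 0")
    case False
    then have "m = n" using shifts_hom_zero[OF t(3) extend.prems(2), of n m] qi t by fastforce
    then have "iso_mor T t (shift T n s) (q \<cdot> i)"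
      using nonzero_iso_shift[of n s' s] nonzero_iso[OF t(3) extend.prems(2)] qi t(1) False by blast
    then obtain e where "iso_mor T X A' e" using section_cone[OF extend.prems(1) extend.hyps(2)] by blast
    then show ?thesis using extend.hyps(3) ext_closure_iso iso_mor_sym by blast
  next
    case True
    then obtain q' where q': "q' \<in> hom T A' (shift T n s)" "q' \<cdot> r = q"
      using weak_cokernel[OF extend.hyps(2) q] by blast
    then have "q' \<noteq> 0" using extend.prems(3) cmp_zero_left[OF r] by auto
    obtain X' p' h' where X': "tri T X' A' (shift T n s) p' q' h'" using ex_fiber[OF q'(1)] by blast
    obtain Y k' l a b c where Y: "tri T Y A (shift T n s) k' q l" "tri T t Y X' a b c"
      using octahedral_fibers[OF extend.hyps(2) X'] q'(2) by auto
    have "X' \<in> ext_closure (shifts T {n..} \<S>)" using extend.IH[OF X' extend.prems(2)] \<open>q' \<noteq> 0\<close> by blast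
    then have "Y \<in> ext_closure (shifts T {n..} \<S>)" using ext_closure.extend[OF extend.hyps(1) Y(2)] by blast
    moreover have "\<exists>e. iso_mor T Y X e" 
      using fiber_unique[OF Y(1) extend.prems(1)] .
    ultimately show ?thesis using ext_closure_iso by blast
  qed
qed

text \<open>
  Let \<open>X\<close> arise from \<open>X'\<close> by a new first factor \<open>t = \<Sigma>\<^sup>ms\<close>, and let \<open>A\<close>, \<open>B\<close> be the high and low parts of
  \<open>X'\<close>. For \<open>m \<ge> n\<close> the factor \<open>t\<close> joins \<open>A\<close>. For \<open>m < n\<close> it has to move past \<open>A\<close>, which is governed by the
  connecting map \<open>c : A \<rightarrow> \<Sigma>\<^sup>m\<^sup>+\<^sup>1s\<close>. If \<open>c = 0\<close>, the extension of \<open>A\<close> by \<open>t\<close> splits and \<open>t\<close> joins \<open>B\<close>; if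
  \<open>c \<noteq> 0\<close>, then \<open>m + 1 = n\<close> for degree reasons and \<open>ext_closure_fiber\<close> absorbs \<open>t\<close> into the high part.
\<close>

lemma ext_closure_truncate:
  "X \<in> ext_closure (shifts T UNIV \<S>) \<Longrightarrow>
    \<exists>A \<in> ext_closure (shifts T {n..} \<S>). \<exists>B \<in> ext_closure (shifts T {..<n} \<S>). \<exists>f g h. tri T A X B f g h"
proof (induction X rule: ext_closure.induct)
  case (zero X)
  then show ?case using tri_idn[OF zero, of X] ext_closure.zero by blast
next
  case (extend t X X' i r k)
  then obtain A B f g h where AB: "A \<in> ext_closure (shifts T {n..} \<S>)" "B \<in> ext_closure (shifts T {..<n} \<S>)"
    "tri T A X' B f g h" by blast
  obtain m s where t: "t = shift T m s" "s \<in> \<S>"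
    using extend.hyps(1) unfolding shifts_def by auto
  obtain Y y1 y3 a b c where Y: "tri T Y X B y1 (g \<cdot> r) y3" and tYA: "tri T t Y A a b c"
    using octahedral_fibers[OF extend.hyps(2) AB(3)] by blast
  have sust: "sus T t = shift T (m + 1) s" using t sus_shift by simp
  show ?case
  proof (cases "m < n")
    case False
    then have "n \<le> m" by simp
    then have "t \<in> shifts T {n..} \<S>" using t unfolding shifts_def by blast
    then have "Y \<in> ext_closure (shifts T {n..} \<S>)" using ext_closure.extend[OF _ tYA AB(1)] by blast
    then show ?thesis using Y AB(2) by blast
  next
    case True
    then have tn: "t \<in> shifts T {..<n} \<S>" using t unfolding shifts_def by blast
    show ?thesis
    proof (cases "c = 0")
      case c0: True
      have "c \<cdot> idn T A = 0" using c0 cmp_zero_left[OF idn_in_hom] by simp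
      then obtain j where j: "j \<in> hom T A Y" "b \<cdot> j = idn T A"
        using weak_kernel[OF tri_rotate_right[OF tYA] idn_in_hom] by blast
      obtain C j2 j3 where C: "tri T A Y C j j2 j3" using tri_cone[OF j(1)] by blast
      obtain e where "iso_mor T t C e"
        using section_cone[OF tYA C] iso_mor_idn[of A] j(2) by auto
      then obtain e' where "iso_mor T C t e'" using iso_mor_sym by blast
      then obtain j2' j3' where At: "tri T A Y t j j2' j3'" using tri_iso_last[OF C] by blast
      obtain W w2 w3 where W: "tri T A X W (y1 \<cdot> j) w2 w3"
        using tri_cone[OF cmp_in_hom[OF j(1) tri_homs(1)[OF Y]]] by blast
      obtain u v w where "tri T t W B u v w" using tri_octahedral[OF At Y W] by blast
      then have "W \<in> ext_closure (shifts T {..<n} \<S>)" using ext_closure.extend[OF tn _ AB(2)] by blast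
      then show ?thesis using W AB(1) by blast
    next
      case c: False
      have "m + 1 = n"
      proof (rule ccontr)
        assume "m + 1 \<noteq> n"
        then have "hom T s' (shift T (m + 1) s) = {0}" if "s' \<in> shifts T {n..} \<S>" for s'
          using that True t(2) shifts_hom_zero[of _ s "m + 1"] unfolding shifts_def by fastforce
        then have "hom T A (shift T (m + 1) s) = {0}" by (rule ext_closure_left_zero[OF AB(1)])
        then show False using c tri_homs(3)[OF tYA] sust by auto
      qed
      then have "Y \<in> ext_closure (shifts T {n..} \<S>)"
        using ext_closure_fiber[OF AB(1) _ t(2) c] tri_rotate_right[OF tYA] sust by metis
      then show ?thesis using Y AB(2) by blast
    qed
  qed
qed

lemma thick_subset_retracts: "thick T \<S> \<subseteq> retracts (ext_closure (shifts T UNIV \<S>))"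
proof -
  let ?F = "ext_closure (shifts T UNIV \<S>)"
  have "sus T s \<in> shifts T UNIV \<S> \<longleftrightarrow> s \<in> shifts T UNIV \<S>" for s
  proof
    assume "sus T s \<in> shifts T UNIV \<S>"
    then obtain n X where nX: "sus T s = shift T n X" "X \<in> \<S>" unfolding shifts_def by auto
    then have "sus T s = sus T (shift T (n - 1) X)" by (simp add: sus_shift)
    then show "s \<in> shifts T UNIV \<S>" using sus_inj nX(2) unfolding shifts_def by blast
  next
    assume "s \<in> shifts T UNIV \<S>"
    then show "sus T s \<in> shifts T UNIV \<S>" unfolding shifts_def using sus_shift by blast
  qed
  then have sus: "sus T X \<in> ?F \<longleftrightarrow> X \<in> ?F" for X by (rule ext_closure_sus)
  have tri: "Z \<in> ?F" if t: "tri T X Y Z f g h" and "X \<in> ?F" "Y \<in> ?F" for X Y Z f g h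
    using ext_closure_tri[OF _ tri_rotate_right[OF t]] that sus by blast
  have "s \<in> ?F" if s: "s \<in> \<S>" for s
  proof -
    obtain Z where Z: "zero_obj T Z" using ex_zero_obj by blast
    have "s \<in> shifts T UNIV \<S>" unfolding shifts_def using s shift_0 by (metis (mono_tags, lifting) UNIV_I mem_Collect_eq)
    then show ?thesis using ext_closure.extend[OF _ tri_idn[OF Z]] ext_closure.zero[OF Z] by blast
  qed
  moreover have "thick_subcategory T (retracts ?F)" "?F \<subseteq> retracts ?F"
    by (rule retracts_thick; fact ext_closure.zero sus tri)+
  ultimately show ?thesis unfolding thick_def by blast
qed

text \<open>
  Let \<open>N\<close> be a retract of \<open>E\<close>, and \<open>A\<close>, \<open>B\<close> the high and low parts of \<open>E\<close>. As \<open>A\<close> has no maps to \<open>N\<close>, the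
  retraction \<open>E \<rightarrow> N\<close> factors through \<open>B\<close>; so every map \<open>M \<rightarrow> N\<close> does, and \<open>M\<close> has no maps to \<open>B\<close>.
\<close>

lemma perp_shifts_orthogonal:
  assumes thick: "thick T \<S> = UNIV"
    and M: "M \<in> left_perp T (shifts T {..<n} \<S>)" and N: "N \<in> right_perp T (shifts T {n..} \<S>)"
  shows "hom T M N = {0}"
proof -
  obtain E i p where E: "E \<in> ext_closure (shifts T UNIV \<S>)" "i \<in> hom T N E" "p \<in> hom T E N" "p \<cdot> i = idn T N"
    using thick_subset_retracts thick unfolding retracts_def by blast
  obtain A B u v w where AB: "A \<in> ext_closure (shifts T {n..} \<S>)" "B \<in> ext_closure (shifts T {..<n} \<S>)" "tri T A E B u v w"
    using ext_closure_truncate[OF E(1)] by blast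
  have "hom T A N = {0}" using N by (intro ext_closure_left_zero[OF AB(1)]) (simp add: right_perp_def)
  then have "p \<cdot> u = 0" using cmp_in_hom[OF tri_homs(1)[OF AB(3)] E(3)] by simp
  then obtain p' where p': "p' \<in> hom T B N" "p' \<cdot> v = p" using weak_cokernel[OF AB(3) E(3)] by blast
  have MB: "hom T M B = {0}" using M by (intro ext_closure_right_zero[OF AB(2)]) (simp add: left_perp_def)
  have "a = 0" if a: "a \<in> hom T M N" for a
  proof -
    have ia: "i \<cdot> a \<in> hom T M E" using cmp_in_hom[OF a E(2)] .
    have "a = p \<cdot> (i \<cdot> a)" using cmp_assoc[OF a E(2,3)] E(4) cmp_idn_left[OF a] by simp
    also have "\<dots> = p' \<cdot> (v \<cdot> (i \<cdot> a))" using cmp_assoc[OF ia tri_homs(2)[OF AB(3)] p'(1)] p'(2) by simp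
    also have "v \<cdot> (i \<cdot> a) = 0" using cmp_in_hom[OF ia tri_homs(2)[OF AB(3)]] MB by simp
    finally show ?thesis using cmp_zero_right[OF p'(1)] by simp
  qed
  then show ?thesis by auto
qed

end

end

section \<open>Calculus of roofs\<close>

context triangulated_category
begin

context
  fixes \<P> :: "'o set"
  assumes thick: "thick_subcategory T \<P>"
begin

lemma thick_zero_obj: "zero_obj T Z \<Longrightarrow> Z \<in> \<P>"
  using thick unfolding thick_subcategory_def by blast

lemma thick_sus: "sus T X \<in> \<P> \<longleftrightarrow> X \<in> \<P>"
  using thick_shift[OF thick, of 1 X] sus_shift[of 0 X] by simp

lemma thick_tri_last: "tri T X Y Z f g h \<Longrightarrow> X \<in> \<P> \<Longrightarrow> Y \<in> \<P> \<Longrightarrow> Z \<in> \<P>"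
  using thick unfolding thick_subcategory_def by (elim conjE) blast

lemma thick_tri_first: "tri T X Y Z f g h \<Longrightarrow> Y \<in> \<P> \<Longrightarrow> Z \<in> \<P> \<Longrightarrow> X \<in> \<P>"
  using thick_tri_last[OF tri_rotate_right] thick_sus by blast

lemma thick_tri_mid: "tri T X Y Z f g h \<Longrightarrow> X \<in> \<P> \<Longrightarrow> Z \<in> \<P> \<Longrightarrow> Y \<in> \<P>"
proof -
  assume t: "tri T X Y Z f g h" and X: "X \<in> \<P>" and Z: "Z \<in> \<P>"
  obtain Z' k where Z': "sus T Z' = Z" "tri T Z' X Y k f g" using tri_rotate_left[OF t] by blast
  then have "Z' \<in> \<P>" using thick_sus[of Z'] Z by simp
  then show "Y \<in> \<P>" using thick_tri_last[OF Z'(2)] X by blast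
qed

lemma cone_in_hom: "cone_in T \<P> W X s \<Longrightarrow> s \<in> hom T W X"
  unfolding cone_in_def using tri_homs(1) by blast

lemma cone_in_idn: "cone_in T \<P> X X (idn T X)"
  unfolding cone_in_def using ex_zero_obj thick_zero_obj tri_idn by blast

lemma cone_in_cmp:
  assumes s: "cone_in T \<P> W X s" and a: "cone_in T \<P> V W a"
  shows "cone_in T \<P> V X (s \<cdot> a)"
proof -
  obtain Z p k where Z: "Z \<in> \<P>" "tri T W X Z s p k" using s unfolding cone_in_def by blast
  obtain Z' p' k' where Z': "Z' \<in> \<P>" "tri T V W Z' a p' k'" using a unfolding cone_in_def by blast
  obtain C l l' where C: "tri T V X C (s \<cdot> a) l l'"
    using tri_cone[OF cmp_in_hom[OF cone_in_hom[OF a] cone_in_hom[OF s]]] by blast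
  obtain u v w where "tri T Z' C Z u v w" using tri_octahedral[OF Z'(2) Z(2) C] by blast
  then have "C \<in> \<P>" using thick_tri_mid Z(1) Z'(1) by blast
  then show ?thesis unfolding cone_in_def using C by blast
qed

lemma cone_in_cancel:
  assumes s: "cone_in T \<P> W X s" and a: "a \<in> hom T V W" and sa: "cone_in T \<P> V X (s \<cdot> a)"
  shows "cone_in T \<P> V W a"
proof -
  obtain Z p k where Z: "Z \<in> \<P>" "tri T W X Z s p k" using s unfolding cone_in_def by blast
  obtain C l l' where C: "C \<in> \<P>" "tri T V X C (s \<cdot> a) l l'" using sa unfolding cone_in_def by blast
  obtain Z' p' k' where Z': "tri T V W Z' a p' k'" using tri_cone[OF a] by blast
  obtain u v w where "tri T Z' C Z u v w" using tri_octahedral[OF Z' Z(2) C(2)] by blast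
  then have "Z' \<in> \<P>" using thick_tri_first Z(1) C(1) by blast
  then show ?thesis unfolding cone_in_def using Z' by blast
qed

text \<open>
  Maps into objects of \<open>\<P>\<close> vanish after refining the source: take the fiber.
\<close>

lemma cone_in_annihilate:
  assumes "U \<in> \<P>" and c: "c \<in> hom T W U"
  shows "\<exists>V d. cone_in T \<P> V W d \<and> c \<cdot> d = 0"
proof -
  obtain V d k where "tri T V W U d c k" using ex_fiber[OF c] by blast
  then show ?thesis unfolding cone_in_def using assms(1) tri_cmp_zero(1) by blast
qed

text \<open>
  The base change \<open>b\<close> of \<open>s\<close> along \<open>a\<close> is the fiber of \<open>a\<close> followed by the map from \<open>A\<close> to the cone of \<open>s\<close>.
\<close>

lemma ore_square:
  assumes s: "cone_in T \<P> W A s" and a: "a \<in> hom T W' A"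
  shows "\<exists>V b c. cone_in T \<P> V W' b \<and> c \<in> hom T V W \<and> s \<cdot> c = a \<cdot> b"
proof -
  obtain Z p k where Z: "Z \<in> \<P>" "tri T W A Z s p k" using s unfolding cone_in_def by blast
  note p = tri_homs(2)[OF Z(2)]
  obtain V b where V: "cone_in T \<P> V W' b" "(p \<cdot> a) \<cdot> b = 0"
    using cone_in_annihilate[OF Z(1) cmp_in_hom[OF a p]] by blast
  note b = cone_in_hom[OF V(1)]
  have "p \<cdot> (a \<cdot> b) = 0" using V(2) cmp_assoc[OF b a p] by simp
  then obtain c where "c \<in> hom T V W" "s \<cdot> c = a \<cdot> b"
    using weak_kernel[OF Z(2) cmp_in_hom[OF b a]] by blast
  then show ?thesis using V(1) by blast
qed

lemma ore_common:
  assumes s: "cone_in T \<P> W A s" and s': "cone_in T \<P> W' A s'"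
  obtains V b b' where "cone_in T \<P> V W b" "cone_in T \<P> V W' b'" "s \<cdot> b = s' \<cdot> b'"
proof -
  obtain V b' b where V: "cone_in T \<P> V W' b'" "b \<in> hom T V W" "s \<cdot> b = s' \<cdot> b'"
    using ore_square[OF s cone_in_hom[OF s']] by blast
  then have "cone_in T \<P> V W b" using cone_in_cancel[OF s V(2)] cone_in_cmp[OF s' V(1)] by simp
  then show thesis using that V by blast
qed

lemma roof_rel_restrict:
  assumes r: "(W, s, u) \<in> roofs T \<P> A X" and b: "cone_in T \<P> V W b"
  shows "((W, s, u), (V, s \<cdot> b, u \<cdot> b)) \<in> roof_rel T \<P> A X" "(V, s \<cdot> b, u \<cdot> b) \<in> roofs T \<P> A X"
proof -
  have s: "cone_in T \<P> W A s" and u: "u \<in> hom T W X" using r unfolding roofs_def by auto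
  note b' = cone_in_hom[OF b]
  have sb: "s \<cdot> b \<in> hom T V A" and ub: "u \<cdot> b \<in> hom T V X"
    using cmp_in_hom[OF b'] cone_in_hom[OF s] u by auto
  show 1: "(V, s \<cdot> b, u \<cdot> b) \<in> roofs T \<P> A X"
    using cone_in_cmp[OF s b] ub unfolding roofs_def by simp
  have "s \<cdot> b = (s \<cdot> b) \<cdot> idn T V" "u \<cdot> b = (u \<cdot> b) \<cdot> idn T V"
    using cmp_idn_right[OF sb] cmp_idn_right[OF ub] by simp_all
  then show "((W, s, u), (V, s \<cdot> b, u \<cdot> b)) \<in> roof_rel T \<P> A X"
    unfolding roof_rel_def using r 1 b' idn_in_hom cone_in_cmp[OF s b] by blast
qed

text \<open>
  The roof \<open>A \<leftarrow> W \<rightarrow> X\<close> and the morphism \<open>t : A \<rightarrow> V\<close> become equal in the quotient, once the former is composed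
  with \<open>g : X \<rightarrow> V\<close>.
\<close>

definition represents :: "'o \<Rightarrow> 'o \<Rightarrow> 'm \<Rightarrow> ('o \<times> 'm \<times> 'm) \<Rightarrow> 'm \<Rightarrow> bool" where
  "represents A V g r t \<longleftrightarrow> (case r of (W, s, u) \<Rightarrow> t \<in> hom T A V \<and>
     (\<exists>W' a. cone_in T \<P> W' W a \<and> g \<cdot> (u \<cdot> a) = t \<cdot> (s \<cdot> a)))"

text \<open>
  The hypothesis \<open>factor\<close> expresses that \<open>V\<close> looks, from \<open>A\<close>, as if it were right orthogonal to \<open>\<P>\<close>.
  The factoring object is \<open>\<Sigma>Q\<close>, so that no desuspension has to be mentioned.
\<close>

context
  fixes A U X V :: 'o and f g h :: 'm
  assumes tri: "tri T U X V f g h" and U: "U \<in> \<P>"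
    and factor: "\<And>Z p. Z \<in> \<P> \<Longrightarrow> p \<in> hom T A Z \<Longrightarrow>
      \<exists>Q. \<exists>q \<in> hom T A (sus T Q). \<exists>r \<in> hom T (sus T Q) Z. p = r \<cdot> q \<and> Q \<in> \<P> \<and>
        hom T (sus T Q) V = {0} \<and> hom T Q V = {0}"
begin

text \<open>
  A map that dies on \<open>W\<close> factors through the cone of \<open>s\<close>, hence through an object without maps to \<open>V\<close>.
\<close>

lemma local_injective:
  assumes s: "cone_in T \<P> W A s" and t: "t \<in> hom T A V" "t \<cdot> s = 0"
  shows "t = 0"
proof -
  obtain Z p k where Z: "Z \<in> \<P>" "tri T W A Z s p k" using s unfolding cone_in_def by blast
  obtain Q q r where Q: "q \<in> hom T A (sus T Q)" "r \<in> hom T (sus T Q) Z" "p = r \<cdot> q" "hom T (sus T Q) V = {0}"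
    using factor[OF Z(1) tri_homs(2)[OF Z(2)]] by blast
  obtain t' where t': "t' \<in> hom T Z V" "t' \<cdot> p = t" using weak_cokernel[OF Z(2) t] by blast
  have "t = (t' \<cdot> r) \<cdot> q" using t'(2) Q(3) cmp_assoc[OF Q(1,2) t'(1)] by simp
  also have "t' \<cdot> r = 0" using cmp_in_hom[OF Q(2) t'(1)] Q(4) by simp
  finally show ?thesis using cmp_zero_left[OF Q(1)] by simp
qed

text \<open>
  Factor the map from \<open>A\<close> to the cone of \<open>s\<close> as \<open>r \<cdot> q\<close>, with \<open>q : A \<rightarrow> \<Sigma>Q\<close>. The fiber \<open>W'\<close> of \<open>q\<close> maps to
  \<open>W\<close>, and the obstruction to extending a map \<open>W' \<rightarrow> V\<close> to \<open>A\<close> lies in \<open>T(Q, V) = 0\<close>.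
\<close>

lemma local_extend:
  assumes s: "cone_in T \<P> W A s"
  obtains W' a where "cone_in T \<P> W' W a"
    "\<And>v. v \<in> hom T W' V \<Longrightarrow> \<exists>t \<in> hom T A V. v = t \<cdot> (s \<cdot> a)"
proof -
  obtain Z p k where Z: "Z \<in> \<P>" "tri T W A Z s p k" using s unfolding cone_in_def by blast
  note p = tri_homs(2)[OF Z(2)]
  obtain Q q r where Q: "q \<in> hom T A (sus T Q)" "r \<in> hom T (sus T Q) Z" "p = r \<cdot> q" "Q \<in> \<P>" "hom T Q V = {0}"
    using factor[OF Z(1) p] by blast
  obtain W' s' k' where W': "tri T W' A (sus T Q) s' q k'" using ex_fiber[OF Q(1)] by blast
  note s' = tri_homs(1)[OF W']
  have cs': "cone_in T \<P> W' A s'" unfolding cone_in_def using W' Q(4) thick_sus by blast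
  have "p \<cdot> s' = 0"
    using Q(3) cmp_assoc[OF s' Q(1,2)] tri_cmp_zero(1)[OF W'] cmp_zero_right[OF Q(2)] by simp
  then obtain a where a: "a \<in> hom T W' W" "s \<cdot> a = s'" using weak_kernel[OF Z(2) s'] by blast
  obtain x where x: "tri T Q W' A x s' q" using tri_rotate_left[OF W'] sus_inj by blast
  show thesis
  proof (rule that)
    show "cone_in T \<P> W' W a" using cone_in_cancel[OF s a(1)] cs' a(2) by simp
    fix v assume v: "v \<in> hom T W' V"
    then have "v \<cdot> x = 0" using cmp_in_hom[OF tri_homs(1)[OF x] v] Q(5) by simp
    then show "\<exists>t \<in> hom T A V. v = t \<cdot> (s \<cdot> a)" using weak_cokernel[OF x v] a(2) by metis
  qed
qed

abbreviation rep where "rep \<equiv> represents A V g"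

lemma rep_exists:
  assumes "(W, s, u) \<in> roofs T \<P> A X"
  shows "\<exists>t. rep (W, s, u) t"
proof -
  have s: "cone_in T \<P> W A s" and u: "u \<in> hom T W X" using assms unfolding roofs_def by auto
  obtain W' a where a: "cone_in T \<P> W' W a"
    "\<And>v. v \<in> hom T W' V \<Longrightarrow> \<exists>t \<in> hom T A V. v = t \<cdot> (s \<cdot> a)"
    using local_extend[OF s] by blast
  have "g \<cdot> (u \<cdot> a) \<in> hom T W' V"
    using cmp_in_hom[OF cmp_in_hom[OF cone_in_hom[OF a(1)] u] tri_homs(2)[OF tri]] .
  then obtain t where "t \<in> hom T A V" "g \<cdot> (u \<cdot> a) = t \<cdot> (s \<cdot> a)" using a(2) by blast
  then show ?thesis unfolding represents_def using a(1) by blast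
qed

lemma rep_refine:
  assumes s: "s \<in> hom T W A" and u: "u \<in> hom T W X" and t: "t \<in> hom T A V"
    and a: "a \<in> hom T W' W" "g \<cdot> (u \<cdot> a) = t \<cdot> (s \<cdot> a)" and d: "d \<in> hom T W'' W'"
  shows "g \<cdot> (u \<cdot> (a \<cdot> d)) = t \<cdot> (s \<cdot> (a \<cdot> d))"
proof -
  have "g \<cdot> (u \<cdot> (a \<cdot> d)) = (g \<cdot> (u \<cdot> a)) \<cdot> d"
    using cmp_assoc[OF d a(1) u] cmp_assoc[OF d cmp_in_hom[OF a(1) u] tri_homs(2)[OF tri]] by simp
  also have "\<dots> = t \<cdot> (s \<cdot> (a \<cdot> d))"
    using a(2) cmp_assoc[OF d a(1) s] cmp_assoc[OF d cmp_in_hom[OF a(1) s] t] by simp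
  finally show ?thesis .
qed

lemma rep_common:
  assumes "(W, s, u) \<in> roofs T \<P> A X" "(W, s, u') \<in> roofs T \<P> A X"
    and r: "rep (W, s, u) t" and r': "rep (W, s, u') t'"
  obtains W' a where "cone_in T \<P> W' W a" "g \<cdot> (u \<cdot> a) = t \<cdot> (s \<cdot> a)" "g \<cdot> (u' \<cdot> a) = t' \<cdot> (s \<cdot> a)"
proof -
  have s: "s \<in> hom T W A" and u: "u \<in> hom T W X" and u': "u' \<in> hom T W X"
    using assms(1,2) cone_in_hom unfolding roofs_def by auto
  obtain W1 a1 where 1: "cone_in T \<P> W1 W a1" "g \<cdot> (u \<cdot> a1) = t \<cdot> (s \<cdot> a1)" and t: "t \<in> hom T A V"
    using r unfolding represents_def by auto
  obtain W2 a2 where 2: "cone_in T \<P> W2 W a2" "g \<cdot> (u' \<cdot> a2) = t' \<cdot> (s \<cdot> a2)" and t': "t' \<in> hom T A V"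
    using r' unfolding represents_def by auto
  obtain W' b1 b2 where b: "cone_in T \<P> W' W1 b1" "cone_in T \<P> W' W2 b2" "a1 \<cdot> b1 = a2 \<cdot> b2"
    using ore_common[OF 1(1) 2(1)] .
  show thesis
  proof (rule that)
    show "cone_in T \<P> W' W (a1 \<cdot> b1)" by (rule cone_in_cmp[OF 1(1) b(1)])
    show "g \<cdot> (u \<cdot> (a1 \<cdot> b1)) = t \<cdot> (s \<cdot> (a1 \<cdot> b1))"
      by (rule rep_refine[OF s u t cone_in_hom[OF 1(1)] 1(2) cone_in_hom[OF b(1)]])
    show "g \<cdot> (u' \<cdot> (a1 \<cdot> b1)) = t' \<cdot> (s \<cdot> (a1 \<cdot> b1))"
      unfolding b(3) by (rule rep_refine[OF s u' t' cone_in_hom[OF 2(1)] 2(2) cone_in_hom[OF b(2)]])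
  qed
qed

lemma rep_unique:
  assumes r: "(W, s, u) \<in> roofs T \<P> A X" and "rep (W, s, u) t" "rep (W, s, u) t'"
  shows "t = t'"
proof -
  obtain W' a where a: "cone_in T \<P> W' W a" "g \<cdot> (u \<cdot> a) = t \<cdot> (s \<cdot> a)" "g \<cdot> (u \<cdot> a) = t' \<cdot> (s \<cdot> a)"
    using rep_common[OF r r assms(2,3)] .
  have s: "cone_in T \<P> W A s" using r unfolding roofs_def by simp
  have t: "t \<in> hom T A V" "t' \<in> hom T A V" using assms(2,3) unfolding represents_def by auto
  note sa = cone_in_cmp[OF s a(1)]
  have "(t - t') \<cdot> (s \<cdot> a) = 0" using cmp_diff_left[OF cone_in_hom[OF sa] t] a(2,3) by simp
  then have "t - t' = 0" using local_injective[OF sa diff_in_hom[OF t]] by blast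
  then show ?thesis by simp
qed

lemma rep_restrict:
  assumes r: "(W, s, u) \<in> roofs T \<P> A X" and rt: "rep (W, s, u) t" and b: "cone_in T \<P> W' W b"
  shows "rep (W', s \<cdot> b, u \<cdot> b) t"
proof -
  have s: "s \<in> hom T W A" and u: "u \<in> hom T W X"
    using r cone_in_hom unfolding roofs_def by auto
  obtain W1 a where a: "cone_in T \<P> W1 W a" "g \<cdot> (u \<cdot> a) = t \<cdot> (s \<cdot> a)" and t: "t \<in> hom T A V"
    using rt unfolding represents_def by auto
  note b' = cone_in_hom[OF b]
  obtain V' c d where V': "cone_in T \<P> V' W' c" "d \<in> hom T V' W1" "a \<cdot> d = b \<cdot> c"
    using ore_square[OF a(1) b'] by blast
  have "g \<cdot> (u \<cdot> (b \<cdot> c)) = t \<cdot> (s \<cdot> (b \<cdot> c))"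
    using rep_refine[OF s u t cone_in_hom[OF a(1)] a(2) V'(2)] V'(3) by simp
  then have "g \<cdot> ((u \<cdot> b) \<cdot> c) = t \<cdot> ((s \<cdot> b) \<cdot> c)"
    using cmp_assoc[OF cone_in_hom[OF V'(1)] b'] s u by simp
  then show ?thesis unfolding represents_def using t V'(1) by auto
qed

text \<open>
  The obstruction to lifting \<open>t : A \<rightarrow> V\<close> to \<open>X\<close> is a map \<open>A \<rightarrow> \<Sigma>U\<close>, which vanishes after a refinement
  because \<open>U\<close> is in \<open>\<P>\<close>.
\<close>

lemma rep_surj:
  assumes t: "t \<in> hom T A V"
  shows "\<exists>r \<in> roofs T \<P> A X. rep r t"
proof -
  note h = tri_homs(3)[OF tri]
  obtain W s where s: "cone_in T \<P> W A s" "(h \<cdot> t) \<cdot> s = 0"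
    using cone_in_annihilate[OF _ cmp_in_hom[OF t h]] U thick_sus by blast
  note s' = cone_in_hom[OF s(1)]
  have "h \<cdot> (t \<cdot> s) = 0" using s(2) cmp_assoc[OF s' t h] by simp
  then obtain u where u: "u \<in> hom T W X" "g \<cdot> u = t \<cdot> s"
    using weak_kernel[OF tri_rotate_right[OF tri] cmp_in_hom[OF s' t]] by blast
  have "g \<cdot> (u \<cdot> idn T W) = t \<cdot> (s \<cdot> idn T W)"
    using u cmp_idn_right[OF u(1)] cmp_idn_right[OF s'] by simp
  then have "rep (W, s, u) t" unfolding represents_def using t cone_in_idn by blast
  moreover have "(W, s, u) \<in> roofs T \<P> A X" using s(1) u(1) unfolding roofs_def by simp
  ultimately show ?thesis by blast
qed

lemma rep_add:
  assumes r: "(W, s, u) \<in> roofs T \<P> A X" "(W, s, u') \<in> roofs T \<P> A X"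
    and rt: "rep (W, s, u) t" "rep (W, s, u') t'"
  shows "rep (W, s, u + u') (t + t')"
proof -
  obtain W' a where a: "cone_in T \<P> W' W a" "g \<cdot> (u \<cdot> a) = t \<cdot> (s \<cdot> a)" "g \<cdot> (u' \<cdot> a) = t' \<cdot> (s \<cdot> a)"
    using rep_common[OF r rt] .
  have s: "s \<in> hom T W A" and u: "u \<in> hom T W X" "u' \<in> hom T W X"
    using r cone_in_hom unfolding roofs_def by auto
  have t: "t \<in> hom T A V" "t' \<in> hom T A V" using rt unfolding represents_def by auto
  note a' = cone_in_hom[OF a(1)]
  have "g \<cdot> ((u + u') \<cdot> a) = (t + t') \<cdot> (s \<cdot> a)"
    using cmp_add_left[OF a' u] cmp_add_left[OF cmp_in_hom[OF a' s] t] a(2,3)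
      cmp_add_right[OF cmp_in_hom[OF a' u(1)] cmp_in_hom[OF a' u(2)] tri_homs(2)[OF tri]] by simp
  then show ?thesis unfolding represents_def using add_in_hom[OF t] a(1) by auto
qed

lemma rep_scl:
  assumes r: "(W, s, u) \<in> roofs T \<P> A X" and rt: "rep (W, s, u) t"
  shows "rep (W, s, scl T c u) (scl T c t)"
proof -
  obtain W' a where a: "cone_in T \<P> W' W a" "g \<cdot> (u \<cdot> a) = t \<cdot> (s \<cdot> a)" and t: "t \<in> hom T A V"
    using rt unfolding represents_def by auto
  have s: "s \<in> hom T W A" and u: "u \<in> hom T W X"
    using r cone_in_hom unfolding roofs_def by auto
  note a' = cone_in_hom[OF a(1)]
  have "g \<cdot> (scl T c u \<cdot> a) = scl T c t \<cdot> (s \<cdot> a)"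
    using cmp_scl_left[OF a' u] cmp_scl_left[OF cmp_in_hom[OF a' s] t] a(2)
      cmp_scl_right[OF cmp_in_hom[OF a' u] tri_homs(2)[OF tri]] by simp
  then show ?thesis unfolding represents_def using scl_in_hom[OF t] a(1) by auto
qed

text \<open>
  The difference of \<open>u\<close> and \<open>u'\<close> dies in \<open>V\<close> after a first refinement, so it comes from \<open>U\<close>, and maps into \<open>U\<close>
  vanish after a second one.
\<close>

lemma rep_same_leg_rel:
  assumes r: "(W, s, u) \<in> roofs T \<P> A X" "(W, s, u') \<in> roofs T \<P> A X"
    and rt: "rep (W, s, u) t" "rep (W, s, u') t"
  shows "\<exists>W' c. cone_in T \<P> W' W c \<and> u \<cdot> c = u' \<cdot> c"
proof -
  obtain W1 a where a: "cone_in T \<P> W1 W a" "g \<cdot> (u \<cdot> a) = t \<cdot> (s \<cdot> a)" "g \<cdot> (u' \<cdot> a) = t \<cdot> (s \<cdot> a)"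
    using rep_common[OF r rt] .
  have u: "u \<in> hom T W X" "u' \<in> hom T W X" using r unfolding roofs_def by auto
  note a' = cone_in_hom[OF a(1)] and g = tri_homs(2)[OF tri] and f = tri_homs(1)[OF tri]
  have ua: "u \<cdot> a \<in> hom T W1 X" "u' \<cdot> a \<in> hom T W1 X" using cmp_in_hom[OF a'] u by auto
  have "g \<cdot> (u \<cdot> a - u' \<cdot> a) = 0" using cmp_diff_right[OF ua g] a(2,3) by simp
  then obtain e where e: "e \<in> hom T W1 U" "f \<cdot> e = u \<cdot> a - u' \<cdot> a"
    using weak_kernel[OF tri diff_in_hom[OF ua]] by blast
  obtain W' d where d: "cone_in T \<P> W' W1 d" "e \<cdot> d = 0" using cone_in_annihilate[OF U e(1)] by blast
  note d' = cone_in_hom[OF d(1)]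
  have "(u \<cdot> a - u' \<cdot> a) \<cdot> d = 0" using e(2) cmp_assoc[OF d' e(1) f] d(2) cmp_zero_right[OF f] by simp
  then have "u \<cdot> (a \<cdot> d) = u' \<cdot> (a \<cdot> d)"
    using cmp_diff_left[OF d' ua] cmp_assoc[OF d' a'] u by simp
  then show ?thesis using cone_in_cmp[OF a(1) d(1)] by blast
qed

lemma roof_common_leg:
  assumes r: "(W, s, u) \<in> roofs T \<P> A X" "(W', s', u') \<in> roofs T \<P> A X"
  obtains V0 b b' where "cone_in T \<P> V0 W b" "cone_in T \<P> V0 W' b'" "s \<cdot> b = s' \<cdot> b'"
  using ore_common[of W A s W' s'] r unfolding roofs_def by auto

lemma rep_roof_rel_iff:
  assumes r: "(W, s, u) \<in> roofs T \<P> A X" "(W', s', u') \<in> roofs T \<P> A X"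
    and rt: "rep (W, s, u) t" "rep (W', s', u') t'"
  shows "((W, s, u), (W', s', u')) \<in> roof_rel T \<P> A X \<longleftrightarrow> t = t'"
proof
  have s: "cone_in T \<P> W A s" "cone_in T \<P> W' A s'" using r unfolding roofs_def by auto
  have u: "u \<in> hom T W X" "u' \<in> hom T W' X" using r unfolding roofs_def by auto
  {
    assume "((W, s, u), (W', s', u')) \<in> roof_rel T \<P> A X"
    then obtain V0 b b' where b: "b \<in> hom T V0 W" "b' \<in> hom T V0 W'" "s \<cdot> b = s' \<cdot> b'" "u \<cdot> b = u' \<cdot> b'"
      "cone_in T \<P> V0 A (s \<cdot> b)"
      unfolding roof_rel_def by blast
    have cb: "cone_in T \<P> V0 W b" using cone_in_cancel[OF s(1) b(1,5)] .
    have cb': "cone_in T \<P> V0 W' b'" using cone_in_cancel[OF s(2) b(2)] b(3,5) by simp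
    show "t = t'"
      using rep_unique[OF roof_rel_restrict(2)[OF r(1) cb] rep_restrict[OF r(1) rt(1) cb]]
        rep_restrict[OF r(2) rt(2) cb'] b(3,4) by simp
  }
  assume tt': "t = t'"
  obtain V0 b b' where b: "cone_in T \<P> V0 W b" "cone_in T \<P> V0 W' b'" "s \<cdot> b = s' \<cdot> b'"
    using roof_common_leg[OF r] .
  note b1 = cone_in_hom[OF b(1)] and b2 = cone_in_hom[OF b(2)]
  have "\<exists>V1 c. cone_in T \<P> V1 V0 c \<and> (u \<cdot> b) \<cdot> c = (u' \<cdot> b') \<cdot> c"
    using rep_same_leg_rel[OF roof_rel_restrict(2)[OF r(1) b(1)] _ rep_restrict[OF r(1) rt(1) b(1)]]
      roof_rel_restrict(2)[OF r(2) b(2)] rep_restrict[OF r(2) rt(2) b(2)] b(3) tt' by simp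
  then obtain V1 c where c: "cone_in T \<P> V1 V0 c" "(u \<cdot> b) \<cdot> c = (u' \<cdot> b') \<cdot> c" by blast
  note c' = cone_in_hom[OF c(1)]
  have "u \<cdot> (b \<cdot> c) = u' \<cdot> (b' \<cdot> c)"
    using c(2) cmp_assoc[OF c' b1 u(1)] cmp_assoc[OF c' b2 u(2)] by simp
  moreover have "s \<cdot> (b \<cdot> c) = s' \<cdot> (b' \<cdot> c)"
    using b(3) cmp_assoc[OF c' b1 cone_in_hom[OF s(1)]] cmp_assoc[OF c' b2 cone_in_hom[OF s(2)]] by simp
  ultimately show "((W, s, u), (W', s', u')) \<in> roof_rel T \<P> A X"
    unfolding roof_rel_def
    using r cmp_in_hom[OF c' b1] cmp_in_hom[OF c' b2] cone_in_cmp[OF s(1) cone_in_cmp[OF b(1) c(1)]] by blast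
qed

text \<open>
  The function \<open>val\<close> sends a roof to the morphism that it represents. By \<open>rep_roof_rel_iff\<close> its fibers
  \<open>cls t\<close> are exactly the equivalence classes of roofs, which also shows that \<open>roof_rel\<close> is an
  equivalence relation.
\<close>

lemma verdier_hom_iso_local: "verdier_hom_iso T \<P> A X A V"
proof -
  let ?R = "roofs T \<P> A X" and ?rel = "roof_rel T \<P> A X"
  define val where "val r = (THE t. rep r t)" for r
  have val_eq: "val r = t" if "r \<in> ?R" "rep r t" for r t
    unfolding val_def using that rep_unique by (cases r) blast
  have rep_val: "rep r (val r)" if "r \<in> ?R" for r
    using that rep_exists val_eq by (cases r) blast
  have rel_iff: "(r, r') \<in> ?rel \<longleftrightarrow> val r = val r'" if "r \<in> ?R" "r' \<in> ?R" for r r'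
    using rep_roof_rel_iff that rep_val by (cases r; cases r') blast
  have rel_R: "r \<in> ?R \<and> r' \<in> ?R" if "(r, r') \<in> ?rel" for r r'
    using that unfolding roof_rel_def by blast
  have val_in: "val r \<in> hom T A V" if "r \<in> ?R" for r
    using rep_val[OF that] unfolding represents_def by (auto split: prod.splits)
  define cls where "cls t = {r \<in> ?R. val r = t}" for t
  have cls_rel: "?rel `` {r} = cls (val r)" if "r \<in> ?R" for r
  proof (rule set_eqI)
    fix r'
    show "r' \<in> ?rel `` {r} \<longleftrightarrow> r' \<in> cls (val r)"
      using rel_iff[OF that, of r'] rel_R[of r r'] unfolding cls_def by auto
  qed
  have cls_ne: "\<exists>r. r \<in> cls t" if t: "t \<in> hom T A V" for t
    unfolding cls_def using rep_surj[OF t] val_eq by blast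
  have cls_image: "?rel `` E = cls t" if "E \<subseteq> cls t" "E \<noteq> {}" for E t
  proof -
    have "?rel `` {r} = cls t" if "r \<in> E" for r
    proof -
      have "r \<in> cls t" using that \<open>E \<subseteq> cls t\<close> by (rule rev_subsetD)
      then have "r \<in> ?R" "val r = t" unfolding cls_def by simp_all
      then show ?thesis using cls_rel by simp
    qed
    then have "(\<Union>r\<in>E. ?rel `` {r}) = cls t" using \<open>E \<noteq> {}\<close> by simp
    moreover have "?rel `` E = (\<Union>r\<in>E. ?rel `` {r})" by (rule Image_eq_UN)
    ultimately show ?thesis by simp
  qed
  have hom_cls: "verdier_hom T \<P> A X = cls ` hom T A V"
  proof (intro equalityI subsetI)
    fix \<alpha> assume "\<alpha> \<in> verdier_hom T \<P> A X"
    then obtain r where "r \<in> ?R" "\<alpha> = ?rel `` {r}" unfolding verdier_hom_def by (rule quotientE)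
    then show "\<alpha> \<in> cls ` hom T A V" using cls_rel val_in by simp
  next
    fix \<alpha> assume "\<alpha> \<in> cls ` hom T A V"
    then obtain t r where "\<alpha> = cls t" "r \<in> cls t" using cls_ne by blast
    then have "r \<in> ?R" "\<alpha> = ?rel `` {r}" using cls_rel unfolding cls_def by auto
    then show "\<alpha> \<in> verdier_hom T \<P> A X" unfolding verdier_hom_def by (simp add: quotientI)
  qed
  have add: "verdier_add T \<P> A X (cls t) (cls t') = cls (t + t')"
    if tt': "t \<in> hom T A V" "t' \<in> hom T A V" for t t'
    unfolding verdier_add_def
  proof (rule cls_image)
    let ?E = "{(W, s, u + u') |W s u u'. (W, s, u) \<in> cls t \<and> (W, s, u') \<in> cls t'}"
    show "?E \<subseteq> cls (t + t')"
    proof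
      fix r assume "r \<in> ?E"
      then obtain W s u u' where r: "r = (W, s, u + u')" "(W, s, u) \<in> cls t" "(W, s, u') \<in> cls t'" by blast
      then have uu: "(W, s, u) \<in> ?R" "(W, s, u') \<in> ?R" "rep (W, s, u) t" "rep (W, s, u') t'"
        using rep_val unfolding cls_def by auto
      have "(W, s, u + u') \<in> ?R" using uu(1,2) add_in_hom unfolding roofs_def by simp
      then show "r \<in> cls (t + t')" using val_eq rep_add[OF uu] r(1) unfolding cls_def by blast
    qed
    \<comment> \<open>Two classes have representatives with a common left leg, by the Ore condition.\<close>
    obtain W s u where 1: "(W, s, u) \<in> cls t" using cls_ne[OF tt'(1)] by (metis prod_cases3)
    obtain W' s' u' where 2: "(W', s', u') \<in> cls t'" using cls_ne[OF tt'(2)] by (metis prod_cases3)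
    have R: "(W, s, u) \<in> ?R" "(W', s', u') \<in> ?R" using 1 2 unfolding cls_def by auto
    obtain V0 b b' where b: "cone_in T \<P> V0 W b" "cone_in T \<P> V0 W' b'" "s \<cdot> b = s' \<cdot> b'"
      using roof_common_leg[OF R] .
    have "(V0, s \<cdot> b, u \<cdot> b) \<in> cls t"
      using roof_rel_restrict[OF R(1) b(1)] cls_rel[OF R(1)] 1 unfolding cls_def by auto
    moreover have "(V0, s \<cdot> b, u' \<cdot> b') \<in> cls t'"
      using roof_rel_restrict[OF R(2) b(2)] cls_rel[OF R(2)] 2 b(3) unfolding cls_def by auto
    ultimately show "?E \<noteq> {}" by blast
  qed
  have scl: "verdier_scl T \<P> A X c (cls t) = cls (scl T c t)" if t: "t \<in> hom T A V" for c t
    unfolding verdier_scl_def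
  proof (rule cls_image)
    let ?E = "{(W, s, scl T c u) |W s u. (W, s, u) \<in> cls t}"
    show "?E \<subseteq> cls (scl T c t)"
    proof
      fix r assume "r \<in> ?E"
      then obtain W s u where r: "r = (W, s, scl T c u)" "(W, s, u) \<in> cls t" by blast
      then have u: "(W, s, u) \<in> ?R" "rep (W, s, u) t" using rep_val unfolding cls_def by auto
      have "(W, s, scl T c u) \<in> ?R" using u(1) scl_in_hom unfolding roofs_def by simp
      then show "r \<in> cls (scl T c t)" using val_eq rep_scl[OF u] r(1) unfolding cls_def by blast
    qed
    show "?E \<noteq> {}" using cls_ne[OF t] by auto
  qed
  define \<phi> where "\<phi> \<alpha> = the_elem (val ` \<alpha>)" for \<alpha>
  have phi: "\<phi> (cls t) = t" if "t \<in> hom T A V" for t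
  proof -
    have "val ` cls t = {t}" using cls_ne[OF that] unfolding cls_def by auto
    then show ?thesis unfolding \<phi>_def by simp
  qed
  have "bij_betw \<phi> (verdier_hom T \<P> A X) (hom T A V)"
    unfolding hom_cls by (rule bij_betw_byWitness[where f' = cls]) (auto simp: phi)
  then show ?thesis
    unfolding verdier_hom_iso_def using hom_cls add scl phi add_in_hom scl_in_hom
    by (intro exI[of _ \<phi>]) auto
qed

end

end

end

section \<open>Calabi--Yau triples\<close>

lemma (in linear_category) dual_space_separates:
  assumes v: "v \<in> hom T X Y" "v \<noteq> 0"
  shows "\<exists>\<xi> \<in> dual_space (scl T) (hom T X Y). \<xi> v \<noteq> 0"
proof -
  define B where "B = hom_space.extend_basis {v}"
  have ind: "hom_space.independent {v}" using v(2) hom_space.dependent_single by blast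
  then have B: "hom_space.independent B" "v \<in> B" "hom_space.span B = UNIV"
    unfolding B_def using hom_space.independent_extend_basis[OF ind]
      hom_space.extend_basis_superset[OF ind] hom_space.span_extend_basis[OF ind] by auto
  define \<xi> where "\<xi> u = (if u \<in> hom T X Y then hom_space.representation B u v else 0)" for u
  have "\<xi> \<in> dual_space (scl T) (hom T X Y)"
    unfolding dual_space_def \<xi>_def
    using B add_in_hom scl_in_hom by (auto simp: hom_space.representation_add hom_space.representation_scale)
  moreover have "\<xi> v = 1"
    unfolding \<xi>_def using v(1) hom_space.representation_basis[OF B(1,2)] by simp
  ultimately show ?thesis using zero_neq_one by metis
qed

context triangulated_category
begin

text \<open>
  A space is zero if its dual is, and the dual of \<open>T(Q, V)\<close> is \<open>T(V, \<Sigma>\<^sup>nQ)\<close>.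
\<close>

lemma relative_serre_hom_zero:
  assumes "relative_serre_duality T \<P> n" and Q: "Q \<in> \<P>" and zero: "hom T V (shift T n Q) = {0}"
  shows "hom T Q V = {0}"
proof -
  let ?D = "dual_space (scl T) (hom T Q V)"
  have "\<exists>\<eta>. \<forall>X\<in>\<P>. \<forall>Y. bij_betw (\<eta> X Y) (dual_space (scl T) (hom T X Y)) (hom T Y (shift T n X))"
    using assms(1) unfolding relative_serre_duality_def by (rule ex_forward) (drule conjunct1, blast)
  then obtain \<eta> where
    "\<forall>X\<in>\<P>. \<forall>Y. bij_betw (\<eta> X Y) (dual_space (scl T) (hom T X Y)) (hom T Y (shift T n X))" by blast
  then have bij: "bij_betw (\<eta> Q V) ?D {0}" using Q zero by metis
  have "v = 0" if v: "v \<in> hom T Q V" for v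
  proof (rule ccontr)
    assume "v \<noteq> 0"
    then obtain \<xi> where \<xi>: "\<xi> \<in> ?D" "\<xi> v \<noteq> 0" using dual_space_separates[OF v] by blast
    have z: "(\<lambda>_. 0) \<in> ?D" unfolding dual_space_def by simp
    have "\<eta> Q V \<xi> = \<eta> Q V (\<lambda>_. 0)" using bij_betwE[OF bij] \<xi>(1) z by simp
    then have "\<xi> = (\<lambda>_. 0)" using bij_betw_imp_inj_on[OF bij] \<xi>(1) z by (simp add: inj_on_def)
    then show False using \<xi>(2) by simp
  qed
  then show ?thesis by auto
qed

lemma image_minus_atLeast: "(\<lambda>k. k - n) ` {m..} = {m - n :: int..}"
proof (intro equalityI subsetI)
  fix x assume "x \<in> {m - n..}"
  then show "x \<in> (\<lambda>k. k - n) ` {m..}" by (intro image_eqI[of _ _ "x + n"]) auto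
qed auto

text \<open>
  The co-t-structure at \<open>0\<close>, transported by \<open>\<Sigma>\<^sup>n\<close>.
\<close>

lemma truncate_at:
  assumes "co_t_structure T (right_perp T (shifts T {0..} \<S>)) (right_perp T (shifts T {..<0} \<S>))"
  obtains Q R f g h where "Q \<in> right_perp T (shifts T {n..} \<S>)"
    "shift T (- n) R \<in> right_perp T (shifts T {..<0} \<S>)" "tri T Q Z R f g h"
proof -
  have "shift T (- n) Z \<in> star T (right_perp T (shifts T {0..} \<S>)) (right_perp T (shifts T {..<0} \<S>))"
    using assms unfolding co_t_structure_def torsion_pair_def by simp
  then obtain Q R f g h where QR: "Q \<in> right_perp T (shifts T {0..} \<S>)" "R \<in> right_perp T (shifts T {..<0} \<S>)"
    "tri T Q (shift T (- n) Z) R f g h"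
    unfolding star_def by blast
  have "\<exists>f g h. tri T (shift T n Q) (shift T n (shift T (- n) Z)) (shift T n R) f g h"
    using tri_shift[of n Q "shift T (- n) Z" R] QR(3) by blast
  then have "\<exists>f g h. tri T (shift T n Q) Z (shift T n R) f g h" by (simp add: shift_add)
  moreover have "shift T n Q \<in> right_perp T (shifts T {n..} \<S>)"
    using QR(1) by (simp add: shift_in_right_perp image_minus_atLeast)
  moreover have "shift T (- n) (shift T n R) \<in> right_perp T (shifts T {..<0} \<S>)"
    using QR(2) by (simp add: shift_add)
  ultimately show thesis using that by blast
qed

lemma shift_right_perp_mono:
  assumes "Q \<in> right_perp T (shifts T {n..} \<S>)" and "n \<le> m + e"
  shows "shift T (- e) Q \<in> right_perp T (shifts T {m..} \<S>)"
  using assms unfolding right_perp_shifts hom_zero_shift_right by (simp add: shift_add)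

end

theorem corollary4p2:
  fixes T :: "('k::alg_closed_field, 'o, 'm::ab_group_add) tri_cat"
    and \<P> \<S> :: "'o set"
    and d j :: int
    and X Y X\<^sub>g\<^sub>t X\<^sub>l\<^sub>e :: 'o
    and f g h :: 'm
  assumes "d \<ge> 0"
    and "neg_CY_triple T \<P> \<S> d"
    and "Y \<in> \<S>"
    and "truncation_triangle T \<S> (- j + d - 1) X\<^sub>g\<^sub>t X X\<^sub>l\<^sub>e f g h"
  shows "verdier_hom_iso T \<P> (shift T j Y) X (shift T j Y) X\<^sub>l\<^sub>e"
proof -
  interpret triangulated_category T using assms(2) unfolding neg_CY_triple_def by blast
  have fin: "hom_finite T" and P: "thick_subcategory T \<P>"
    and serre: "relative_serre_duality T \<P> (- d)" and smc: "simple_minded T \<S>"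
    and cot: "co_t_structure T (right_perp T (shifts T {0..} \<S>)) (right_perp T (shifts T {..<0} \<S>))"
    and left: "left_perp T (shifts T {0..} \<S>) \<subseteq> \<P>"
    and right: "right_perp T (shifts T {..<0} \<S>) \<subseteq> \<P>"
    using assms(2) unfolding neg_CY_triple_def by blast+
  define n where "n = j - d + 1"
  have gt: "X\<^sub>g\<^sub>t \<in> left_perp T (shifts T {n..} \<S>)" and le: "X\<^sub>l\<^sub>e \<in> left_perp T (shifts T {..<n} \<S>)"
    and tri: "tri T X\<^sub>g\<^sub>t X X\<^sub>l\<^sub>e f g h"
    using assms(4) unfolding truncation_triangle_def trunc_gt_def trunc_le_def n_def
    by (auto simp: left_perp_shifts)
  have "shift T (- n) X\<^sub>g\<^sub>t \<in> left_perp T (shifts T {0..} \<S>)"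
    using gt shift_in_left_perp[of "- n" "X\<^sub>g\<^sub>t" "{0..}" \<S>]
      image_minus_atLeast[of "- n" 0] by simp
  then have U: "X\<^sub>g\<^sub>t \<in> \<P>" using left thick_shift[OF P] by blast
  have neg: "hom T s (shift T m s') = {0}" if "s \<in> \<S>" "s' \<in> \<S>" "m < 0" for s s' m
    using smc that unfolding simple_minded_def by blast
  have thickS: "thick T \<S> = UNIV" using smc unfolding simple_minded_def by blast
  have orth: "hom T X\<^sub>l\<^sub>e N = {0}" if "N \<in> right_perp T (shifts T {n..} \<S>)" for N
    using perp_shifts_orthogonal[OF neg simple_minded_nonzero_iso[OF fin smc] thickS le that] by blast
  \<comment> \<open>Serre duality turns maps from \<open>Q\<close> into maps to \<open>\<Sigma>\<^sup>-\<^sup>dQ\<close>, which has no maps from degrees above \<open>j - d\<close>.\<close>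
  have van: "hom T Q X\<^sub>l\<^sub>e = {0}" if "Q \<in> \<P>" "Q \<in> right_perp T (shifts T {j + 1..} \<S>)" for Q
    using relative_serre_hom_zero[OF serre that(1)] orth shift_right_perp_mono[OF that(2), of n d]
    unfolding n_def by simp
  show ?thesis
  proof (rule verdier_hom_iso_local[OF P tri U])
    fix Z p assume Z: "Z \<in> \<P>" and p: "p \<in> hom T (shift T j Y) Z"
    \<comment> \<open>Truncating in degree \<open>j + 1\<close> leaves an \<open>R\<close> without maps from \<open>\<Sigma>\<^sup>jY\<close>, so \<open>p\<close> lifts to \<open>Q'\<close>.\<close>
    obtain Q' R a b c where QR: "Q' \<in> right_perp T (shifts T {j + 1..} \<S>)"
      "shift T (- (j + 1)) R \<in> right_perp T (shifts T {..<0} \<S>)" "tri T Q' Z R a b c"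
      using truncate_at[OF cot] .
    have "R \<in> \<P>" using QR(2) right thick_shift[OF P] by blast
    then have Q': "Q' \<in> \<P>" using thick_tri_first[OF P QR(3) Z] by blast
    obtain Q where Q: "sus T Q = Q'" using sus_surj by blast
    then have QP: "Q \<in> \<P>" using Q' thick_sus[OF P] by blast
    have "Q = shift T (- 1) Q'" using Q sus_inj[of Q "shift T (- 1) Q'"] sus_shift[of "- 1" Q'] by simp
    then have "Q \<in> right_perp T (shifts T {j + 1..} \<S>)"
      using shift_right_perp_mono[OF QR(1), of "j + 1" 1] by simp
    then have "hom T Q X\<^sub>l\<^sub>e = {0}" "hom T Q' X\<^sub>l\<^sub>e = {0}" using van QP Q' QR(1) by auto
    moreover have "hom T (shift T (- 1) Y) (shift T (- (j + 1)) R) = {0}"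
      using QR(2) assms(3) unfolding right_perp_shifts by simp
    then have "hom T (shift T j Y) R = {0}"
      using hom_zero_shift[of "j + 1" "shift T (- 1) Y" "shift T (- (j + 1)) R"] by (simp add: shift_add)
    then have "b \<cdot>\<^bsub>T\<^esub> p = 0" using cmp_in_hom[OF p tri_homs(2)[OF QR(3)]] by simp
    then obtain q where "q \<in> hom T (shift T j Y) Q'" "a \<cdot>\<^bsub>T\<^esub> q = p"
      using weak_kernel[OF QR(3) p] by blast
    ultimately show "\<exists>Q. \<exists>q \<in> hom T (shift T j Y) (sus T Q). \<exists>r \<in> hom T (sus T Q) Z.
        p = r \<cdot>\<^bsub>T\<^esub> q \<and> Q \<in> \<P> \<and> hom T (sus T Q) X\<^sub>l\<^sub>e = {0} \<and> hom T Q X\<^sub>l\<^sub>e = {0}"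
      using Q QP tri_homs(1)[OF QR(3)] by blast
  qed
qed

end
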